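(* Let $f$ be a spectral density on $\Lambda=[-\pi,\pi]$ and let $\overline{E_f}$ be the closure of its spectrum $E_f=\{e^{i\lambda}: f(\lambda)>0\}\subset\mathbb T$. Assume that $\overline{E_f}$ is the union of finitely many closed arcs of the unit circle $\mathbb{T}$ and that $f>0$ almost everywhere on $\{\lambda: e^{i\lambda}\in\overline{E_f}\}$. Then the sequence $\sqrt[n]{\sigma_n(f)}$ converges and $$\lim_{n\to\infty}\sqrt[n]{\sigma_n(f)}=\tau(\overline{E_f}),$$ where $\tau$ denotes the transfinite diameter.
   Context: $\Lambda=[-\pi,\pi]$, $\mathbb T=\{z\in\mathbb C:|z|=1\}$. A spectral density is a function $f\ge 0$, $f\in L^1(\Lambda)$, positive on a set of positive Lebesgue measure; its covariances are $r(t)=\int_\Lambda e^{-it\lambda}f(\lambda)\,d\lambda$. For $n\in\mathbb N$ the finite (one-step) prediction error is $\sigma_n^2(f)=\min_{c_1,\dots,c_n\in\mathbb C}\int_\Lambda\big|1-\sum_{k=1}^n c_k e^{-ik\lambda}\big|^2 f(\lambda)\,d\lambda$ (the mean squared error of the best linear predictor of $X(0)$ from $X(-n),\dots,X(-1)$ for a stationary sequence $X$ with spectral density $f$), and $\sigma_n(f)=\sqrt{\sigma_n^2(f)}$. Transfinite diameter: for a compact $F\subset\mathbb C$ and $n\ge2$, $d_n(F)=\max_{z_1,\dots,z_n\in F}\big(\prod_{1\le j<k\le n}|z_j-z_k|\big)^{2/(n(n-1))}$; $\tau(F)=\lim_{n\to\infty}d_n(F)$ (the limit exists), with $\tau(F)=0$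 if $F$ is finite or empty. (It coincides with the logarithmic capacity and the Chebyshev constant.) *)

theory Defs
  imports "HOL-Analysis.Analysis"
begin

definition spectral_density :: "(real \<Rightarrow> real) \<Rightarrow> bool" where
  "spectral_density f \<longleftrightarrow>
     (\<forall>l\<in>{-pi..pi}. f l \<ge> 0) \<and> f integrable_on {-pi..pi} \<and>
     emeasure lebesgue {l \<in> {-pi..pi}. f l > 0} > 0"

definition pred_error_sq :: "nat \<Rightarrow> (real \<Rightarrow> real) \<Rightarrow> real" where
  "pred_error_sq n f = Inf (range (\<lambda>c::nat \<Rightarrow> complex.
     integral {-pi..pi} (\<lambda>l. (cmod (1 - (\<Sum>k=1..n. c k * cis (- (real k * l)))))\<^sup>2 * f l)))"

definition pred_error :: "nat \<Rightarrow> (real \<Rightarrow> real) \<Rightarrow> real" where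
  "pred_error n f = sqrt (pred_error_sq n f)"

definition spectrum_set :: "(real \<Rightarrow> real) \<Rightarrow> complex set" where
  "spectrum_set f = {cis l | l. l \<in> {-pi..pi} \<and> f l > 0}"

text \<open>n-th diameter d_n(F), n >= 2.\<close>
definition diam_n :: "nat \<Rightarrow> complex set \<Rightarrow> real" where
  "diam_n n F = Sup {(\<Prod>(j,k)\<in>{(j,k). j < k \<and> k < n}. cmod (z j - z k))
                        powr (2 / (real n * (real n - 1))) | z. \<forall>i<n. z i \<in> F}"

definition transfinite_diameter :: "complex set \<Rightarrow> real" where
  "transfinite_diameter F = (if finite F then 0 else lim (\<lambda>n. diam_n n F))"

definition closed_arc :: "real \<Rightarrow> real \<Rightarrow> complex set" where
  "closed_arc a b = cis ` {a..b}"

end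

theory Submission
  imports Defs
begin

text \<open>
  Multiplying by \<open>e\<^bsup>in\<lambda>\<^esup>\<close> turns \<open>\<sigma>\<^sub>n\<^sup>2(f)\<close> into the minimum of \<open>\<integral>|Q|\<^sup>2 f\<close> over monic polynomials \<open>Q\<close>
  of degree \<open>n\<close>. Let \<open>K\<close> be the closed spectrum, \<open>\<tau>\<close> its transfinite diameter and \<open>d\<^sub>n\<close> its
  decreasing sequence of \<open>n\<close>-th diameters.

  Upper bound: the polynomial with roots at almost extremal points for \<open>d\<^sub>n\<close> is bounded on \<open>K\<close> by the
  quotient of consecutive extremal Vandermonde products, hence by \<open>2 d\<^sub>n\<^sup>n\<close>.

  Lower bound: if \<open>\<integral>|Q|\<^sup>2 f\<close> is small, then by Markov's inequality \<open>|Q|\<close> is small on a compact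
  \<open>G \<subseteq> K\<close> that misses only a set of small measure. The map \<open>s \<mapsto> |G \<inter> [a,s]|\<close> is 1-Lipschitz, and its
  inverses on the single arcs compose to a map from \<open>K\<close> into \<open>G\<close> that shrinks distances by a factor
  close to 1 at most; hence the transfinite diameter of \<open>G\<close> is almost \<open>\<tau>\<close>. On the other hand, Lagrange
  interpolation of \<open>Q\<^sup>q z\<^sup>r\<close> bounds the Vandermonde products of points of \<open>G\<close> in terms of the supremum
  of \<open>|Q|\<close> on \<open>G\<close>, which must therefore be at least \<open>\<tau>(G)\<^sup>n\<close>.
\<close>

section \<open>Absolute discriminants of finite sets and the transfinite diameter\<close>

text \<open>This is the square of the Vandermonde product: every unordered pair occurs twice.\<close>

definition abs_disc :: "complex set \<Rightarrow> real" where
  "abs_disc S = (\<Prod>x\<in>S. \<Prod>y\<in>S-{x}. cmod (x - y))"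

lemma abs_disc_pos: "finite S \<Longrightarrow> abs_disc S > 0"
  unfolding abs_disc_def by (intro prod_pos) auto

text \<open>The removed point occurs once as outer and once as inner index, hence the
  square.\<close>

lemma abs_disc_remove:
  assumes "finite S" "x \<in> S"
  shows "abs_disc S = abs_disc (S - {x}) * (\<Prod>y\<in>S-{x}. cmod (x - y))\<^sup>2"
proof -
  have inner: "(\<Prod>w\<in>S-{y}. cmod (y - w)) = cmod (x - y) * (\<Prod>w\<in>S-{x}-{y}. cmod (y - w))"
    if "y \<in> S - {x}" for y
  proof -
    have "S - {y} - {x} = S - {x} - {y}" by auto
    then show ?thesis
      using prod.remove[of "S - {y}" x "\<lambda>w. cmod (y - w)"] assms that
      by (auto simp: norm_minus_commute)
  qed
  have "abs_disc S = (\<Prod>y\<in>S-{x}. cmod (x - y)) * (\<Prod>y\<in>S-{x}. \<Prod>w\<in>S-{y}. cmod (y - w))"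
    unfolding abs_disc_def using prod.remove[OF assms] by simp
  also have "(\<Prod>y\<in>S-{x}. \<Prod>w\<in>S-{y}. cmod (y - w))
      = (\<Prod>y\<in>S-{x}. cmod (x - y)) * abs_disc (S - {x})"
    unfolding abs_disc_def by (simp add: inner prod.distrib[symmetric])
  finally show ?thesis by (simp add: power2_eq_square)
qed

lemma abs_disc_insert:
  assumes "finite S" "x \<notin> S"
  shows "abs_disc (insert x S) = abs_disc S * (\<Prod>y\<in>S. cmod (x - y))\<^sup>2"
  using abs_disc_remove[of "insert x S" x] assms by simp

text \<open>Multiplying \<open>abs_disc_remove\<close> over all points counts every pair in the
  \<open>n - 1\<close> deletions that keep it. This identity is what makes the diameters
  decrease.\<close>

lemma abs_disc_power_eq_prod:
  assumes "finite S" "card S = Suc n" "n \<ge> 1"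
  shows "abs_disc S ^ (n - 1) = (\<Prod>x\<in>S. abs_disc (S - {x}))"
proof -
  have "abs_disc S ^ Suc n = (\<Prod>x\<in>S. abs_disc (S - {x}) * (\<Prod>y\<in>S-{x}. cmod (x - y))\<^sup>2)"
    unfolding assms(2)[symmetric] prod_constant[symmetric]
    using abs_disc_remove[OF assms(1)] by (intro prod.cong) auto
  also have "\<dots> = (\<Prod>x\<in>S. abs_disc (S - {x})) * (abs_disc S)\<^sup>2"
    by (simp add: prod.distrib abs_disc_def prod_power_distrib)
  finally have "abs_disc S ^ (n - 1) * (abs_disc S)\<^sup>2 = (\<Prod>x\<in>S. abs_disc (S - {x})) * (abs_disc S)\<^sup>2"
    using assms(3) by (simp flip: power_add)
  then show ?thesis
    using abs_disc_pos[OF assms(1)] by simp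
qed

text \<open>Passes from the index pairs in \<open>diam_n\<close> to a set of points. In the
  induction the new point contributes the pairs \<open>(j, n)\<close>, whose squared product is the
  factor in \<open>abs_disc_insert\<close>.\<close>

lemma prod_pairs_power2:
  fixes z :: "nat \<Rightarrow> complex"
  assumes "inj_on z {..<n}"
  shows "(\<Prod>(j,k)\<in>{(j,k). j < k \<and> k < n}. cmod (z j - z k))\<^sup>2 = abs_disc (z ` {..<n})"
  using assms
proof (induction n)
  case 0
  then show ?case by (simp add: abs_disc_def)
next
  case (Suc n)
  have fin: "finite {(j,k). j < k \<and> k < n}"
    by (rule finite_subset[of _ "{..<n} \<times> {..<n}"]) auto
  have split: "{(j,k). j < k \<and> k < Suc n} = {(j,k). j < k \<and> k < n} \<union> (\<lambda>j. (j,n)) ` {..<n}"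
    by (auto simp: less_Suc_eq)
  have "(\<Prod>(j,k)\<in>{(j,k). j < k \<and> k < Suc n}. cmod (z j - z k))
     = (\<Prod>(j,k)\<in>{(j,k). j < k \<and> k < n}. cmod (z j - z k)) * (\<Prod>j<n. cmod (z j - z n))"
    unfolding split
    by (subst prod.union_disjoint) (auto simp: fin prod.reindex inj_on_def)
  moreover have inj: "inj_on z {..<n}" "z n \<notin> z ` {..<n}"
    using Suc.prems by (auto simp: lessThan_Suc)
  moreover have "(\<Prod>j<n. cmod (z j - z n)) = (\<Prod>y\<in>z ` {..<n}. cmod (z n - y))"
    using inj by (simp add: prod.reindex norm_minus_commute)
  ultimately show ?case
    using Suc.IH by (simp add: lessThan_Suc abs_disc_insert power_mult_distrib)
qed

text \<open>The exponent of \<open>diam_n\<close> is twice the reciprocal of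
  \<open>n * (n - 1)\<close>; the 2 is absorbed by squaring the product.\<close>

lemma prod_pairs_powr:
  fixes z :: "nat \<Rightarrow> complex"
  assumes "inj_on z {..<n}" "n \<ge> 2"
  shows "(\<Prod>(j,k)\<in>{(j,k). j < k \<and> k < n}. cmod (z j - z k)) powr (2 / (real n * (real n - 1)))
     = root (n * (n - 1)) (abs_disc (z ` {..<n}))"
proof -
  define V where "V = (\<Prod>(j,k)\<in>{(j,k). j < k \<and> k < n}. cmod (z j - z k))"
  have "V \<ge> 0" unfolding V_def by (intro prod_nonneg) auto
  moreover have V2: "V\<^sup>2 = abs_disc (z ` {..<n})"
    unfolding V_def by (rule prod_pairs_power2) fact
  ultimately have pos: "V > 0" using abs_disc_pos[of "z ` {..<n}"] by (cases "V = 0") auto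
  have nn: "real (n * (n - 1)) = real n * (real n - 1)" using assms(2) by (simp add: of_nat_diff)
  have "root (n * (n - 1)) (V\<^sup>2) = (V powr 2) powr (1 / real (n * (n - 1)))"
    using pos assms(2) by (subst root_powr_inverse) (auto simp: powr_realpow)
  also have "\<dots> = V powr (2 / (real n * (real n - 1)))"
    unfolding nn by (simp add: powr_powr)
  finally show ?thesis using V2 V_def by simp
qed

lemma prod_pairs_eq_0:
  fixes z :: "nat \<Rightarrow> complex"
  assumes "\<not> inj_on z {..<n}"
  shows "(\<Prod>(j,k)\<in>{(j,k). j < k \<and> k < n}. cmod (z j - z k)) = 0"
proof -
  obtain j k where "j < k" "k < n" "z j = z k"
    using assms unfolding inj_on_def by (metis lessThan_iff linorder_neqE_nat)
  moreover have "finite {(j,k). j < k \<and> k < n}"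
    by (rule finite_subset[of _ "{..<n} \<times> {..<n}"]) auto
  ultimately show ?thesis by (intro prod_zero) auto
qed

text \<open>A chord of the unit circle has length at most 2. This crude bound makes the supremum in
  \<open>diam_n\<close> finite.\<close>

lemma abs_disc_le_2_power:
  assumes "S \<subseteq> sphere 0 1" "card S = n" "n > 0"
  shows "abs_disc S \<le> 2 ^ (n * (n - 1))"
proof -
  have fin: "finite S" using assms card_gt_0_iff by blast
  have "abs_disc S \<le> (\<Prod>x\<in>S. \<Prod>y\<in>S-{x}. 2)"
    unfolding abs_disc_def
  proof (intro prod_mono conjI prod_nonneg norm_ge_zero)
    fix x y assume "x \<in> S" "y \<in> S - {x}"
    then have "cmod x = 1" "cmod y = 1" using assms(1) by auto
    then show "cmod (x - y) \<le> 2" using norm_triangle_ineq4[of x y] by simp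
  qed
  also have "\<dots> = 2 ^ (n * (n - 1))"
    using assms fin by (simp add: power_mult[symmetric] mult.commute)
  finally show ?thesis .
qed

section \<open>Diameters as suprema over finite subsets\<close>

context
  fixes F :: "complex set" and n :: nat
  assumes F: "F \<subseteq> sphere 0 1" "infinite F" and n: "n \<ge> 2"
begin

lemma bdd_above_root_abs_disc:
  "bdd_above {root (n * (n - 1)) (abs_disc S) | S. S \<subseteq> F \<and> card S = n}"
proof (rule bdd_aboveI)
  fix x assume "x \<in> {root (n * (n - 1)) (abs_disc S) | S. S \<subseteq> F \<and> card S = n}"
  then obtain S where S: "S \<subseteq> F" "card S = n" "x = root (n * (n - 1)) (abs_disc S)" by auto
  have "abs_disc S \<le> 2 ^ (n * (n - 1))"
    using S F n by (intro abs_disc_le_2_power) auto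
  then have "x \<le> root (n * (n - 1)) (2 ^ (n * (n - 1)))"
    unfolding S(3) using n by (intro real_root_le_mono) auto
  then show "x \<le> 2" using n by (simp add: real_root_power_cancel)
qed

text \<open>An injective tuple has the same value as its range. A tuple with a repeated point has
  value 0, which cannot raise the supremum, since \<open>F\<close> has an \<open>n\<close>-point
  subset and the values of such subsets are nonnegative.\<close>

lemma diam_n_eq_Sup:
  "diam_n n F = Sup {root (n * (n - 1)) (abs_disc S) | S. S \<subseteq> F \<and> card S = n}" (is "_ = Sup ?B")
proof -
  define A where "A = {(\<Prod>(j,k)\<in>{(j,k). j < k \<and> k < n}. cmod (z j - z k))
                        powr (2 / (real n * (real n - 1))) | z. \<forall>i<n. z i \<in> F}"
  have BA: "?B \<subseteq> A"
  proof
    fix x assume "x \<in> ?B"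
    then obtain S where S: "S \<subseteq> F" "card S = n" "x = root (n * (n - 1)) (abs_disc S)" by auto
    have "finite S" using S n card_gt_0_iff by fastforce
    then obtain z where z: "bij_betw z {..<n} S"
      using S ex_bij_betw_nat_finite atLeast0LessThan by metis
    have "\<forall>i<n. z i \<in> F" using z S by (auto simp: bij_betw_def)
    moreover have "x = (\<Prod>(j,k)\<in>{(j,k). j < k \<and> k < n}. cmod (z j - z k))
                        powr (2 / (real n * (real n - 1)))"
      using z prod_pairs_powr[of z n] n S by (auto simp: bij_betw_def)
    ultimately show "x \<in> A" unfolding A_def by blast
  qed
  have AB: "A \<subseteq> insert 0 ?B"
  proof
    fix x assume "x \<in> A"
    then obtain z where z: "\<forall>i<n. z i \<in> F"
      "x = (\<Prod>(j,k)\<in>{(j,k). j < k \<and> k < n}. cmod (z j - z k)) powr (2 / (real n * (real n - 1)))"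
      unfolding A_def by blast
    show "x \<in> insert 0 ?B"
    proof (cases "inj_on z {..<n}")
      case True
      then have "x = root (n * (n - 1)) (abs_disc (z ` {..<n}))"
        using z prod_pairs_powr[of z n] n by simp
      moreover have "z ` {..<n} \<subseteq> F" "card (z ` {..<n}) = n"
        using z True by (auto simp: card_image)
      ultimately show ?thesis by blast
    next
      case False
      then show ?thesis using z prod_pairs_eq_0[of z n] by simp
    qed
  qed
  obtain S0 where S0: "S0 \<subseteq> F" "card S0 = n" "finite S0"
    using infinite_arbitrarily_large[OF F(2), of n] by blast
  have nz: "root (n * (n - 1)) (abs_disc S0) \<ge> 0"
    using abs_disc_pos[OF S0(3)] by (intro real_root_pos_pos_le) simp
  note bdd = bdd_above_root_abs_disc
  have "Sup A = Sup ?B"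
  proof (rule antisym)
    have "A \<noteq> {}" using BA S0 by blast
    then show "Sup A \<le> Sup ?B"
    proof (rule cSup_least)
      fix x assume "x \<in> A"
      then consider "x = 0" | "x \<in> ?B" using AB by blast
      then show "x \<le> Sup ?B"
      proof cases
        case 1
        have "root (n * (n - 1)) (abs_disc S0) \<le> Sup ?B"
          using S0 bdd by (intro cSup_upper) auto
        then show ?thesis using nz 1 by linarith
      next
        case 2
        then show ?thesis using bdd by (rule cSup_upper)
      qed
    qed
    have "bdd_above A" using bdd by (intro bdd_above_mono[OF _ AB]) simp
    then show "Sup ?B \<le> Sup A" using S0 BA by (intro cSup_subset_mono) auto
  qed
  then show ?thesis unfolding diam_n_def A_def .
qed

lemma abs_disc_le_diam_n:
  assumes "S \<subseteq> F" "card S = n"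
  shows "abs_disc S \<le> diam_n n F ^ (n * (n - 1))"
proof -
  have fin: "finite S" using assms n card_gt_0_iff by fastforce
  have "root (n * (n - 1)) (abs_disc S) \<le> diam_n n F"
    unfolding diam_n_eq_Sup
  proof (rule cSup_upper)
    show "root (n * (n - 1)) (abs_disc S) \<in> {root (n * (n - 1)) (abs_disc S) | S. S \<subseteq> F \<and> card S = n}"
      using assms by blast
  qed (rule bdd_above_root_abs_disc)
  then have "root (n * (n - 1)) (abs_disc S) ^ (n * (n - 1)) \<le> diam_n n F ^ (n * (n - 1))"
    using abs_disc_pos[OF fin] by (intro power_mono real_root_pos_pos_le) auto
  then show ?thesis using abs_disc_pos[OF fin] n by (simp add: real_root_pow_pos2)
qed

lemma diam_n_le:
  assumes "\<And>S. S \<subseteq> F \<Longrightarrow> card S = n \<Longrightarrow> abs_disc S \<le> c ^ (n * (n - 1))" "c \<ge> 0"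
  shows "diam_n n F \<le> c"
  unfolding diam_n_eq_Sup
proof (rule cSup_least)
  show "{root (n * (n - 1)) (abs_disc S) | S. S \<subseteq> F \<and> card S = n} \<noteq> {}"
    using infinite_arbitrarily_large[OF F(2), of n] by blast
next
  fix x assume "x \<in> {root (n * (n - 1)) (abs_disc S) | S. S \<subseteq> F \<and> card S = n}"
  then obtain S where S: "S \<subseteq> F" "card S = n" "x = root (n * (n - 1)) (abs_disc S)" by auto
  have "x \<le> root (n * (n - 1)) (c ^ (n * (n - 1)))"
    unfolding S(3) using n assms S by (intro real_root_le_mono) auto
  then show "x \<le> c" using n assms by (simp add: real_root_power_cancel)
qed

lemma diam_n_pos: "diam_n n F > 0"
proof -
  obtain S0 where S0: "S0 \<subseteq> F" "card S0 = n" "finite S0"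
    using infinite_arbitrarily_large[OF F(2), of n] by blast
  have "0 < diam_n n F ^ (n * (n - 1))"
    using abs_disc_le_diam_n[OF S0(1,2)] abs_disc_pos[OF S0(3)] by linarith
  moreover have "diam_n n F \<ge> 0"
    unfolding diam_n_eq_Sup
  proof (rule cSup_upper2)
    show "root (n * (n - 1)) (abs_disc S0) \<in> {root (n * (n - 1)) (abs_disc S) | S. S \<subseteq> F \<and> card S = n}"
      using S0 by blast
    show "0 \<le> root (n * (n - 1)) (abs_disc S0)"
      using abs_disc_pos[OF S0(3)] by (intro real_root_pos_pos_le) simp
  qed (rule bdd_above_root_abs_disc)
  ultimately show ?thesis using n by (cases "diam_n n F = 0") (auto simp: power_0_left split: if_splits)
qed

text \<open>The slack factor 4 stands in for attainment of the supremum. Its square root is the 2 in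
  \<open>fekete_polynomial\<close>, and it vanishes in the later limits.\<close>

lemma near_extremal_set:
  obtains S where "S \<subseteq> F" "card S = n" "abs_disc S \<ge> diam_n n F ^ (n * (n - 1)) / 4"
proof -
  define N where "N = n * (n - 1)"
  have N: "N > 0" using n by (simp add: N_def)
  define D where "D = diam_n n F ^ N"
  have D: "D > 0" unfolding D_def using diam_n_pos by simp
  have "\<exists>S\<subseteq>F. card S = n \<and> abs_disc S \<ge> D / 4"
  proof (rule ccontr)
    assume "\<not> ?thesis"
    then have small: "abs_disc S \<le> D / 4" if "S \<subseteq> F" "card S = n" for S
      using that by force
    have rt: "root N (D / 4) ^ N = D / 4" using D N by (intro real_root_pow_pos2) auto
    have ge0: "root N (D / 4) \<ge> 0" using D by (intro real_root_pos_pos_le) auto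
    have "diam_n n F \<le> root N (D / 4)"
      using small ge0 by (intro diam_n_le) (simp_all only: rt N_def[symmetric])
    then have "D \<le> root N (D / 4) ^ N"
      unfolding D_def using diam_n_pos by (intro power_mono) auto
    then show False using rt D by simp
  qed
  then show ?thesis using that unfolding D_def N_def by blast
qed

end

text \<open>Every deletion \<open>S - {x}\<close> has \<open>n\<close> points, so
  \<open>abs_disc_power_eq_prod\<close> bounds the \<open>(n - 1)\<close>-st power of the
  discriminant by the diameter to the power \<open>(n + 1) * n * (n - 1)\<close>. Then an
  \<open>(n - 1)\<close>-st root is taken.\<close>

lemma diam_n_Suc_le:
  assumes F: "F \<subseteq> sphere 0 1" "infinite F" and n: "n \<ge> 2"
  shows "diam_n (Suc n) F \<le> diam_n n F"
proof (rule diam_n_le[OF F])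
  show "2 \<le> Suc n" "0 \<le> diam_n n F" using n diam_n_pos[OF F n] by auto
  fix S assume S: "S \<subseteq> F" "card S = Suc n"
  then have fin: "finite S" using card_gt_0_iff by fastforce
  have "abs_disc S ^ (n - 1) = (\<Prod>x\<in>S. abs_disc (S - {x}))"
    using abs_disc_power_eq_prod[OF fin S(2)] n by simp
  also have "\<dots> \<le> (\<Prod>x\<in>S. diam_n n F ^ (n * (n - 1)))"
    using S fin by (intro prod_mono conjI abs_disc_le_diam_n[OF F n] less_imp_le[OF abs_disc_pos]) auto
  also have "\<dots> = (diam_n n F ^ (Suc n * (Suc n - 1))) ^ (n - 1)"
    using S by (simp only: prod_constant power_mult[symmetric] diff_Suc_1 mult_ac)
  finally show "abs_disc S \<le> diam_n n F ^ (Suc n * (Suc n - 1))"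
    using n diam_n_pos[OF F n] by (subst (asm) power_mono_iff) (auto intro: less_imp_le abs_disc_pos fin)
qed

section \<open>Monic polynomials and the transfinite diameter\<close>

text \<open>Compare the coefficients of degree \<open>n\<close> in Lagrange's interpolation formula,
  whose unnormalized basis polynomials \<open>B x\<close> are monic of degree
  \<open>n\<close>.\<close>

lemma lagrange_lead_coeff:
  fixes P :: "'a :: field poly"
  assumes "finite S" "card S = Suc n" "degree P = n"
  shows "(\<Sum>x\<in>S. poly P x / (\<Prod>y\<in>S-{x}. x - y)) = lead_coeff P"
proof -
  define B where "B x = (\<Prod>y\<in>S-{x}. [:-y, 1:])" for x
  define L where "L = (\<Sum>x\<in>S. smult (poly P x / (\<Prod>y\<in>S-{x}. x - y)) (B x))"
  have deg: "degree (B x) = n" if "x \<in> S" for x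
    unfolding B_def using that assms by (subst degree_prod_sum_eq) auto
  have lc: "coeff (B x) n = 1" if "x \<in> S" for x
    using lead_coeff_prod[of "\<lambda>y. [:-y, 1:]" "S-{x}"] deg[OF that] by (simp add: B_def)
  have "P = L"
  proof (rule poly_eqI_degree[of S])
    fix x assume x: "x \<in> S"
    have "poly L x = (\<Sum>w\<in>S. poly P w / (\<Prod>y\<in>S-{w}. w - y) * (\<Prod>y\<in>S-{w}. x - y))"
      by (simp add: L_def B_def poly_sum poly_prod)
    also have "\<dots> = (\<Sum>w\<in>S. if w = x then poly P x else 0)"
      using assms x by (intro sum.cong) auto
    also have "\<dots> = poly P x" using assms x by simp
    finally show "poly P x = poly L x" by simp
  next
    have "degree L \<le> n"
      unfolding L_def using deg by (intro degree_sum_le assms order.trans[OF degree_smult_le]) auto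
    then show "degree L < card S" "degree P < card S" using assms by auto
  qed
  then have "lead_coeff P = coeff L n" using assms by simp
  also have "\<dots> = (\<Sum>x\<in>S. poly P x / (\<Prod>y\<in>S-{x}. x - y))"
    unfolding L_def coeff_sum using lc by simp
  finally show ?thesis by simp
qed

text \<open>For monic \<open>P\<close> the Lagrange sum has modulus 1. Multiplying by
  \<open>sqrt (abs_disc S)\<close> cancels the denominators, because \<open>abs_disc_remove\<close>
  contains their squares.\<close>

lemma sqrt_abs_disc_le_sum:
  assumes "finite S" "card S = Suc n" "degree P = n" "lead_coeff P = 1"
  shows "sqrt (abs_disc S) \<le> (\<Sum>x\<in>S. cmod (poly P x) * sqrt (abs_disc (S - {x})))"
proof -
  have "1 = cmod (\<Sum>x\<in>S. poly P x / (\<Prod>y\<in>S-{x}. x - y))"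
    using lagrange_lead_coeff[OF assms(1-3)] assms(4) by simp
  also have "\<dots> \<le> (\<Sum>x\<in>S. cmod (poly P x) / (\<Prod>y\<in>S-{x}. cmod (x - y)))"
    by (rule order.trans[OF norm_sum]) (simp add: norm_divide prod_norm)
  finally have "sqrt (abs_disc S) * 1
      \<le> sqrt (abs_disc S) * (\<Sum>x\<in>S. cmod (poly P x) / (\<Prod>y\<in>S-{x}. cmod (x - y)))"
    using abs_disc_pos[OF assms(1)] by (intro mult_left_mono) auto
  also have "\<dots> = (\<Sum>x\<in>S. cmod (poly P x) * sqrt (abs_disc (S - {x})))"
    unfolding sum_distrib_left
  proof (rule sum.cong[OF refl])
    fix x assume x: "x \<in> S"
    have "(\<Prod>y\<in>S-{x}. cmod (x - y)) > 0" by (intro prod_pos) auto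
    then show "sqrt (abs_disc S) * (cmod (poly P x) / (\<Prod>y\<in>S-{x}. cmod (x - y)))
        = cmod (poly P x) * sqrt (abs_disc (S - {x}))"
      using abs_disc_remove[OF assms(1) x] by (simp add: real_sqrt_mult)
  qed
  finally show ?thesis by simp
qed

text \<open>Points are removed one at a time. Each removal uses a monic test polynomial whose degree
  is one less than the number of points left, and the number of summands produces the
  factorial.\<close>

lemma sqrt_abs_disc_le_monic_bound:
  assumes G: "G \<subseteq> sphere 0 1" and Q: "degree Q = n" "lead_coeff Q = 1"
    and M: "\<And>w. w \<in> G \<Longrightarrow> cmod (poly Q w) \<le> M" "M \<ge> 0"
  shows "\<lbrakk>finite S; S \<subseteq> G; card S = m\<rbrakk> \<Longrightarrow> sqrt (abs_disc S) \<le> fact m * M ^ (\<Sum>k<m. k div n)"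
proof (induction m arbitrary: S)
  case 0
  then show ?case by (simp add: abs_disc_def)
next
  case (Suc m)
  \<comment> \<open>The power of \<open>z\<close> fills the degree up to \<open>m\<close> and has
    modulus 1 on the circle, so only the factor \<open>Q ^ (m div n)\<close> affects the
    bound.\<close>
  define P where "P = Q ^ (m div n) * monom 1 (m mod n)"
  have Q0: "Q \<noteq> 0" using Q by auto
  have degP: "degree P = m"
    unfolding P_def using Q0 by (simp add: degree_mult_eq degree_power_eq degree_monom_eq Q)
  have lcP: "lead_coeff P = 1"
    unfolding P_def lead_coeff_mult lead_coeff_power using Q by (simp add: degree_monom_eq)
  have "sqrt (abs_disc S) \<le> (\<Sum>x\<in>S. cmod (poly P x) * sqrt (abs_disc (S - {x})))"
    using Suc degP lcP by (intro sqrt_abs_disc_le_sum) auto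
  also have "\<dots> \<le> (\<Sum>x\<in>S. M ^ (m div n) * (fact m * M ^ (\<Sum>k<m. k div n)))"
  proof (intro sum_mono mult_mono)
    fix x assume x: "x \<in> S"
    then have xG: "x \<in> G" using Suc by auto
    then have "cmod x = 1" using G by auto
    then show "cmod (poly P x) \<le> M ^ (m div n)"
      using M(1)[OF xG] by (simp add: P_def poly_monom norm_mult norm_power power_mono)
    show "sqrt (abs_disc (S - {x})) \<le> fact m * M ^ (\<Sum>k<m. k div n)"
      using Suc x by (intro Suc.IH) auto
    show "0 \<le> sqrt (abs_disc (S - {x}))"
      using Suc.prems by (intro real_sqrt_ge_zero less_imp_le[OF abs_disc_pos]) auto
  qed (use M in auto)
  also have "\<dots> = fact (Suc m) * M ^ (\<Sum>k<Suc m. k div n)"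
    using Suc.prems by (simp add: power_add mult_ac)
  finally show ?case .
qed

text \<open>The indices split into \<open>N\<close> blocks of length \<open>n\<close> on which the
  quotient is constant. The factor 2 matches the squaring that turns
  \<open>sqrt (abs_disc S)\<close> into \<open>abs_disc S\<close>.\<close>

lemma sum_div_lessThan:
  fixes n N :: nat
  assumes "n > 0"
  shows "2 * (\<Sum>k<N * n. k div n) = n * (N * (N - 1))"
proof -
  have "(\<Sum>k<N * n. k div n) = (\<Sum>i<N. \<Sum>k=i * n..<i * n + n. k div n)"
    by (rule sum.nat_group[symmetric])
  also have "\<dots> = (\<Sum>i<N. \<Sum>k=i * n..<i * n + n. i)"
  proof (intro sum.cong refl)
    fix i k assume "k \<in> {i * n..<i * n + n}"
    then show "k div n = i"
      by (intro div_nat_eqI) (auto simp: mult.commute)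
  qed
  also have "2 * \<dots> = n * (N * (N - 1))"
  proof (induction N)
    case (Suc N)
    then show ?case by (cases N) (auto simp: algebra_simps)
  qed simp
  finally show ?thesis .
qed

text \<open>Carries near-extremal sets of the arcs over to the compact subset; every ordered pair
  costs at most one factor \<open>\<kappa>\<close>.\<close>

lemma abs_disc_image_ge:
  assumes "finite S" "\<kappa> > 0"
    and "\<And>x y. x \<in> S \<Longrightarrow> y \<in> S \<Longrightarrow> cmod (p x - p y) \<ge> \<kappa> * cmod (x - y)"
  shows "inj_on p S" "abs_disc (p ` S) \<ge> \<kappa> ^ (card S * (card S - 1)) * abs_disc S"
proof -
  show inj: "inj_on p S"
  proof (rule inj_onI)
    fix x y assume "x \<in> S" "y \<in> S" "p x = p y"
    then have "\<kappa> * cmod (x - y) \<le> 0" using assms(3)[of x y] by simp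
    then show "x = y" using assms(2) by (simp add: mult_le_0_iff)
  qed
  have "abs_disc (p ` S) = (\<Prod>x\<in>S. \<Prod>y\<in>S-{x}. cmod (p x - p y))"
    unfolding abs_disc_def prod.reindex[OF inj] o_def
  proof (rule prod.cong[OF refl])
    fix x assume "x \<in> S"
    then have "p ` S - {p x} = p ` (S - {x})" using inj by (auto simp: inj_on_def)
    moreover have "inj_on p (S - {x})" using inj by (rule inj_on_subset) auto
    ultimately show "(\<Prod>y\<in>p ` S - {p x}. cmod (p x - y)) = (\<Prod>y\<in>S-{x}. cmod (p x - p y))"
      by (simp add: prod.reindex)
  qed
  moreover have "(\<Prod>x\<in>S. \<Prod>y\<in>S-{x}. cmod (p x - p y)) \<ge> (\<Prod>x\<in>S. \<Prod>y\<in>S-{x}. \<kappa> * cmod (x - y))"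
    using assms by (intro prod_mono conjI prod_nonneg) auto
  moreover have "(\<Prod>x\<in>S. \<Prod>y\<in>S-{x}. \<kappa> * cmod (x - y)) = \<kappa> ^ (card S * (card S - 1)) * abs_disc S"
    unfolding prod.distrib abs_disc_def using assms by (simp add: power_mult[symmetric] mult.commute)
  ultimately show "abs_disc (p ` S) \<ge> \<kappa> ^ (card S * (card S - 1)) * abs_disc S" by simp
qed

lemma diam_n_tendsto:
  assumes F: "F \<subseteq> sphere 0 1" "infinite F"
  shows "(\<lambda>n. diam_n n F) \<longlonglongrightarrow> transfinite_diameter F"
    and "n \<ge> 2 \<Longrightarrow> transfinite_diameter F \<le> diam_n n F"
    and "transfinite_diameter F \<ge> 0"
proof -
  \<comment> \<open>Monotonicity and positivity hold from index 2 on, hence the shift.\<close>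
  define X where "X n = diam_n (n + 2) F" for n
  have dec: "decseq X"
    unfolding X_def by (rule decseq_SucI) (use diam_n_Suc_le[OF F] in simp)
  have pos: "X n \<ge> 0" for n using diam_n_pos[OF F, of "n + 2"] by (simp add: X_def)
  obtain l where l: "X \<longlonglongrightarrow> l" "\<And>i. l \<le> X i"
    using decseq_convergent[OF dec, of 0] pos by auto
  have lim: "(\<lambda>n. diam_n n F) \<longlonglongrightarrow> l"
    using l(1) unfolding X_def by (rule LIMSEQ_offset)
  then have l_eq: "transfinite_diameter F = l"
    using F by (simp add: transfinite_diameter_def limI)
  show "(\<lambda>n. diam_n n F) \<longlonglongrightarrow> transfinite_diameter F" using lim l_eq by simp
  show "transfinite_diameter F \<le> diam_n n F" if "n \<ge> 2"
    using l(2)[of "n - 2"] that l_eq unfolding X_def by (simp only: le_add_diff_inverse2)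
  show "transfinite_diameter F \<ge> 0"
    using l_eq l(1) pos by (auto intro: LIMSEQ_le_const)
qed

text \<open>The roots form a near-extremal set \<open>S\<close>. Adding a point \<open>w\<close> to
  \<open>S\<close> multiplies the discriminant by the square of \<open>|Q(w)|\<close>, while the
  discriminant of \<open>n + 1\<close> points is at most \<open>d ^ (n * (n + 1))\<close>. The
  quotient of the two bounds is \<open>4 * d ^ (2 * n)\<close>.\<close>

lemma fekete_polynomial:
  assumes F: "F \<subseteq> sphere 0 1" "infinite F" and n: "n \<ge> 2"
  obtains Q where "degree Q = n" "lead_coeff Q = 1"
    "\<And>w. w \<in> F \<Longrightarrow> cmod (poly Q w) \<le> 2 * diam_n n F ^ n"
proof -
  define d where "d = diam_n n F"
  have d: "d > 0" unfolding d_def by (rule diam_n_pos[OF F n])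
  obtain S where S: "S \<subseteq> F" "card S = n" "abs_disc S \<ge> d ^ (n * (n - 1)) / 4"
    unfolding d_def by (rule near_extremal_set[OF F n])
  have fin: "finite S" using S n card_gt_0_iff by fastforce
  define Q where "Q = (\<Prod>x\<in>S. [:-x, 1:])"
  have deg: "degree Q = n"
    unfolding Q_def using S by (subst degree_prod_sum_eq) auto
  have lc: "lead_coeff Q = 1"
    unfolding Q_def lead_coeff_prod by simp
  have "cmod (poly Q w) \<le> 2 * d ^ n" if w: "w \<in> F" for w
  proof (cases "w \<in> S")
    case True
    then have "poly Q w = 0" using fin by (auto simp: Q_def poly_prod)
    then show ?thesis using d by simp
  next
    case False
    have Qw: "cmod (poly Q w) = (\<Prod>y\<in>S. cmod (w - y))"
      by (simp add: Q_def poly_prod prod_norm)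
    have e: "Suc n * (Suc n - 1) = n * (n - 1) + 2 * n"
      using n by (cases n) auto
    have "abs_disc S * (cmod (poly Q w))\<^sup>2 = abs_disc (insert w S)"
      unfolding Qw using abs_disc_insert[OF fin False] by simp
    also have "\<dots> \<le> diam_n (Suc n) F ^ (Suc n * (Suc n - 1))"
      using S w False n fin by (intro abs_disc_le_diam_n[OF F]) auto
    also have "\<dots> \<le> d ^ (Suc n * (Suc n - 1))"
      unfolding d_def using diam_n_pos[OF F, of "Suc n"] n
      by (intro power_mono diam_n_Suc_le[OF F]) auto
    also have "\<dots> = d ^ (n * (n - 1)) * d ^ (2 * n)"
      unfolding e power_add ..
    finally have "d ^ (n * (n - 1)) / 4 * (cmod (poly Q w))\<^sup>2 \<le> d ^ (n * (n - 1)) * d ^ (2 * n)"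
      using mult_right_mono[OF S(3), of "(cmod (poly Q w))\<^sup>2"] by simp
    then have "d ^ (n * (n - 1)) * (cmod (poly Q w))\<^sup>2 \<le> d ^ (n * (n - 1)) * (2 * d ^ n)\<^sup>2"
      by (simp add: power_mult_distrib power_mult[symmetric] mult_ac)
    then have "(cmod (poly Q w))\<^sup>2 \<le> (2 * d ^ n)\<^sup>2"
      using d by (subst (asm) mult_le_cancel_left_pos) auto
    then show ?thesis by (rule power2_le_imp_le) (use d in simp)
  qed
  then show ?thesis using that deg lc unfolding d_def by blast
qed

text \<open>A near-extremal set of \<open>N * n\<close> points of \<open>K\<close> is moved into
  \<open>G\<close> by \<open>p\<close>. There its discriminant is bounded below by a power of
  \<open>\<kappa>\<close> times the transfinite diameter, and above by powers of \<open>M\<close>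
  and a factorial. Taking logarithms, dividing by \<open>N\<close> and letting \<open>N\<close> grow
  removes the factorial and all constants.\<close>

lemma monic_bound_ge_transfinite_diameter:
  assumes K: "K \<subseteq> sphere 0 1" "infinite K" and G: "G \<subseteq> sphere 0 1"
    and p: "p ` K \<subseteq> G" "\<And>x y. x \<in> K \<Longrightarrow> y \<in> K \<Longrightarrow> cmod (p x - p y) \<ge> \<kappa> * cmod (x - y)" "\<kappa> > 0"
    and Q: "degree Q = n" "lead_coeff Q = 1" "n > 0"
    and M: "\<And>w. w \<in> G \<Longrightarrow> cmod (poly Q w) \<le> M" "M > 0"
  shows "(\<kappa> * transfinite_diameter K) ^ n \<le> M"
proof (cases "transfinite_diameter K = 0")
  case True
  then show ?thesis using Q M by (simp add: power_0_left)
next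
  case False
  define t where "t = \<kappa> * transfinite_diameter K"
  have tau: "transfinite_diameter K > 0" using diam_n_tendsto(3)[OF K] False by simp
  then have t: "t > 0" using p by (simp add: t_def)
  \<comment> \<open>This is the logarithm of the comparison of discriminants, divided by the number
    \<open>m = N * n\<close> of points. The factorial enters through \<open>m ^ m\<close>, and
    \<open>ln 4\<close> is generously enlarged to \<open>m * ln 4\<close> before the
    division.\<close>
  have ineq: "(real (N * n) - 1) * ln t \<le> ln 4 + 2 * ln (real (N * n)) + (real N - 1) * ln M"
    if N: "N \<ge> 2" for N
  proof -
    define m where "m = N * n"
    have m: "m \<ge> 2" using N Q by (simp add: m_def) (metis One_nat_def Suc_leI le_trans mult_le_mono mult.right_neutral numeral_2_eq_2)
    obtain S where S: "S \<subseteq> K" "card S = m" "abs_disc S \<ge> diam_n m K ^ (m * (m - 1)) / 4"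
      by (rule near_extremal_set[OF K m])
    have fin: "finite S" using S m card_gt_0_iff by fastforce
    have img: "inj_on p S" "abs_disc (p ` S) \<ge> \<kappa> ^ (card S * (card S - 1)) * abs_disc S"
      using abs_disc_image_ge[of S \<kappa> p] fin p S by blast+
    have "sqrt (abs_disc (p ` S)) \<le> fact m * M ^ (\<Sum>k<m. k div n)"
      using S p fin img M by (intro sqrt_abs_disc_le_monic_bound[OF G Q(1,2)]) (auto simp: card_image)
    then have "(sqrt (abs_disc (p ` S)))\<^sup>2 \<le> (fact m * M ^ (\<Sum>k<m. k div n))\<^sup>2"
      by (intro power_mono) (auto intro: less_imp_le abs_disc_pos fin)
    then have up: "abs_disc (p ` S) \<le> (fact m)\<^sup>2 * M ^ (n * (N * (N - 1)))"
      using abs_disc_pos[of "p ` S"] fin sum_div_lessThan[OF Q(3), of N]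
      by (simp add: power_mult_distrib m_def power_mult[symmetric] mult.commute[of _ 2])
    have fm: "(fact m)\<^sup>2 \<le> (real m ^ m)\<^sup>2"
      using fact_le_power[of m, where 'a = real] by (intro power_mono) auto
    have "t ^ (m * (m - 1)) \<le> \<kappa> ^ (m * (m - 1)) * diam_n m K ^ (m * (m - 1))"
      unfolding t_def power_mult_distrib using p(3) tau
      by (intro mult_left_mono power_mono diam_n_tendsto(2)[OF K m]) auto
    also have "\<dots> \<le> \<kappa> ^ (m * (m - 1)) * (4 * abs_disc S)"
      using S p(3) by (intro mult_left_mono) auto
    also have "\<dots> \<le> 4 * abs_disc (p ` S)"
      using img(2) S by simp
    also have "\<dots> \<le> 4 * ((real m ^ m)\<^sup>2 * M ^ (n * (N * (N - 1))))"
      using order.trans[OF up mult_right_mono[OF fm]] M by (intro mult_left_mono) auto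
    finally have "ln (t ^ (m * (m - 1))) \<le> ln (4 * ((real m ^ m)\<^sup>2 * M ^ (n * (N * (N - 1)))))"
      using t by (subst ln_le_cancel_iff) (use m M in auto)
    moreover have "ln (4 * ((real m ^ m)\<^sup>2 * M ^ (n * (N * (N - 1)))))
        = ln 4 + 2 * (real m * ln (real m)) + real (n * (N * (N - 1))) * ln M"
      using m M by (simp add: ln_mult ln_realpow)
    ultimately have "real (m * (m - 1)) * ln t \<le> ln 4 + 2 * (real m * ln (real m)) + real (n * (N * (N - 1))) * ln M"
      using t by (simp add: ln_realpow)
    also have "real (m * (m - 1)) = real m * (real m - 1)" using m by (simp add: of_nat_diff)
    also have "real (n * (N * (N - 1))) = real m * (real N - 1)" using N by (simp add: m_def of_nat_diff)
    finally have "real m * ((real m - 1) * ln t) \<le> ln 4 + real m * (2 * ln (real m) + (real N - 1) * ln M)"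
      by (simp add: algebra_simps)
    also have "\<dots> \<le> real m * (ln 4 + 2 * ln (real m) + (real N - 1) * ln M)"
      using m by (simp add: distrib_left)
    finally show ?thesis
      using m unfolding m_def[symmetric] by (subst (asm) mult_le_cancel_left_pos) auto
  qed
  have lim0: "(\<lambda>N. c / real N) \<longlonglongrightarrow> 0" for c :: real
    by (rule lim_const_over_n)
  have "(\<lambda>N. (real n - 1 / real N) * ln t) \<longlonglongrightarrow> (real n - 0) * ln t"
    by (intro tendsto_intros lim0)
  moreover have "(\<lambda>N. (ln 4 + 2 * ln (real n)) / real N + 2 * (ln (real N) / real N) + (1 - 1 / real N) * ln M)
      \<longlonglongrightarrow> 0 + 2 * 0 + (1 - 0) * ln M"
    by (intro tendsto_intros lim0 lim_ln_over_n)
  moreover have "\<forall>\<^sub>F N in sequentially. (real n - 1 / real N) * ln t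
      \<le> (ln 4 + 2 * ln (real n)) / real N + 2 * (ln (real N) / real N) + (1 - 1 / real N) * ln M"
    using eventually_ge_at_top[of 2]
  proof eventually_elim
    case (elim N)
    have "(real (N * n) - 1) * ln t / real N \<le> (ln 4 + 2 * ln (real (N * n)) + (real N - 1) * ln M) / real N"
      using ineq[OF elim] elim by (intro divide_right_mono) auto
    moreover have "(real (N * n) - 1) * ln t / real N = (real n - 1 / real N) * ln t"
      using elim by (simp add: field_simps)
    moreover have "(ln 4 + 2 * ln (real (N * n)) + (real N - 1) * ln M) / real N =
        (ln 4 + 2 * ln (real n)) / real N + 2 * (ln (real N) / real N) + (1 - 1 / real N) * ln M"
      using elim Q(3) by (simp add: ln_mult field_simps)
    ultimately show ?case by simp
  qed
  ultimately have "(real n - 0) * ln t \<le> 0 + 2 * 0 + (1 - 0) * ln M"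
    by (intro tendsto_le[OF trivial_limit_sequentially]) auto
  then have "ln (t ^ n) \<le> ln M" using t by (simp add: ln_realpow)
  then show ?thesis using t M by (simp add: t_def)
qed

section \<open>Expanding maps of the circle into large subsets of arcs\<close>

text \<open>The point \<open>\<sigma> t\<close> cuts off from \<open>\<Gamma>\<close> the same
  proportion of measure as \<open>t\<close> cuts off from the interval. Since \<open>m\<close> is
  1-Lipschitz, its inverse cannot shrink distances. The inequalities at the two endpoints later
  control distances to points outside the arc.\<close>

lemma compact_stretch:
  fixes a b :: real
  assumes "a < b" "compact \<Gamma>" "\<Gamma> \<subseteq> {a..b}" "\<kappa> > 0" "measure lebesgue \<Gamma> \<ge> \<kappa> * (b - a)"
  obtains \<sigma> where "\<And>t. t \<in> {a..b} \<Longrightarrow> \<sigma> t \<in> \<Gamma>"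
    "\<And>t. t \<in> {a..b} \<Longrightarrow> \<kappa> * (t - a) \<le> \<sigma> t - a"
    "\<And>t. t \<in> {a..b} \<Longrightarrow> \<kappa> * (b - t) \<le> b - \<sigma> t"
    "\<And>t t'. t \<in> {a..b} \<Longrightarrow> t' \<in> {a..b} \<Longrightarrow> t \<le> t' \<Longrightarrow> \<kappa> * (t' - t) \<le> \<sigma> t' - \<sigma> t"
proof -
  define m where "m s = measure lebesgue (\<Gamma> \<inter> {a..s})" for s
  define g where "g = measure lebesgue \<Gamma>"
  have lm: "\<Gamma> \<inter> {u..v} \<in> lmeasurable" for u v
    using assms(2) by (intro lmeasurable_compact compact_Int) auto
  have m_mono: "m s \<le> m s'" if "s \<le> s'" for s s'
    unfolding m_def using that lm by (intro measure_mono_fmeasurable) (auto intro: fmeasurableD)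
  have m_lip: "m s' - m s \<le> s' - s" if "s \<le> s'" for s s'
  proof -
    have "m s' \<le> measure lebesgue (\<Gamma> \<inter> {a..s} \<union> {s..s'})"
      unfolding m_def using that lm
      by (intro measure_mono_fmeasurable fmeasurable.Un) (auto intro: fmeasurableD)
    also have "\<dots> \<le> m s + measure lebesgue {s..s'}"
      unfolding m_def using lm by (intro measure_Un_le) (auto intro: fmeasurableD)
    finally show ?thesis using that by simp
  qed
  have m_a: "m a = 0"
    unfolding m_def by (rule negligible_imp_measure0, rule negligible_subset[of "{a}"]) auto
  have m_b: "m b = g" using assms(3) by (simp add: m_def g_def Int_absorb2)
  have g0: "g \<ge> \<kappa> * (b - a)" "g > 0"
    using assms by (auto simp: g_def intro: less_le_trans[of _ "\<kappa> * (b - a)"])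
  have cont: "continuous_on X m" for X
  proof (rule continuous_on_subset[OF lipschitz_on_continuous_on])
    show "1-lipschitz_on UNIV m"
    proof (rule lipschitz_onI)
      fix x y :: real
      show "dist (m x) (m y) \<le> 1 * dist x y"
        using m_mono[of x y] m_mono[of y x] m_lip[of x y] m_lip[of y x]
        by (auto simp: dist_real_def abs_if)
    qed simp
  qed simp
  \<comment> \<open>The least \<open>s\<close> with \<open>m s = u\<close> lies in
    \<open>\<Gamma>\<close>: otherwise \<open>\<Gamma>\<close> misses an interval just to the left
    of \<open>s\<close>, and the value \<open>u\<close> would be taken earlier. Positivity of
    \<open>u\<close> ensures that \<open>s\<close> differs from \<open>a\<close>.\<close>
  have half: "u \<in> m ` \<Gamma>" if u: "u \<in> {0<..g}" for u
  proof -
    define S where "S = {s \<in> {a..b}. m s = u}"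
    have "\<exists>s\<ge>a. s \<le> b \<and> m s = u"
      using u m_a m_b assms(1) by (intro IVT' cont) auto
    then have ne: "S \<noteq> {}" by (auto simp: S_def)
    have "compact S"
      unfolding S_def using continuous_closed_preimage[OF cont[of "{a..b}"], of "{u}"]
      by (auto simp: compact_eq_bounded_closed vimage_def Int_def intro: bounded_subset[of "{a..b}"])
    then have "Inf S \<in> S"
      using ne by (intro closed_contains_Inf compact_imp_closed bounded_imp_bdd_below compact_imp_bounded)
    define s where "s = Inf S"
    have s: "s \<in> {a..b}" "m s = u" using \<open>Inf S \<in> S\<close> by (auto simp: s_def S_def)
    have least: "s \<le> x" if "x \<in> S" for x
      unfolding s_def using that \<open>compact S\<close>
      by (intro cInf_lower bounded_imp_bdd_below compact_imp_bounded)
    have "s \<in> \<Gamma>"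
    proof (rule ccontr)
      assume "s \<notin> \<Gamma>"
      then obtain h where h: "h > 0" "ball s h \<subseteq> - \<Gamma>"
        using assms(2) by (metis ComplI compact_imp_closed open_Compl open_contains_ball)
      have "s \<noteq> a" using s u m_a by auto
      define s0 where "s0 = max a (s - h / 2)"
      have s0: "s0 < s" "a \<le> s0" "s0 > s - h" using s \<open>s \<noteq> a\<close> h by (auto simp: s0_def)
      have "x \<notin> \<Gamma>" if "s0 < x" "x \<le> s" for x
        using h(2) that s0 by (auto simp: subset_eq dist_real_def)
      then have "x \<le> s0" if "x \<in> \<Gamma>" "x \<le> s" for x using that by (meson not_le)
      then have "\<Gamma> \<inter> {a..s} = \<Gamma> \<inter> {a..s0}" using s0 by auto
      then have "s0 \<in> S" using s s0 by (auto simp: S_def m_def)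
      then show False using least[of s0] s0 by simp
    qed
    then show ?thesis using s by auto
  qed
  \<comment> \<open>The remaining value 0 is a limit of attained values, and the image of the
    compact set is closed.\<close>
  have "{0..g} \<subseteq> m ` \<Gamma>"
  proof -
    have "closed (m ` \<Gamma>)"
      using compact_continuous_image[OF cont assms(2)] compact_imp_closed by blast
    then have "closure {0<..g} \<subseteq> m ` \<Gamma>" using half by (intro closure_minimal) auto
    then show ?thesis using g0 by simp
  qed
  moreover have "g * ((t - a) / (b - a)) \<in> {0..g}" if "t \<in> {a..b}" for t
    using that assms(1) g0 by (auto simp: mult_le_cancel_left1 divide_le_eq)
  ultimately have "\<forall>t\<in>{a..b}. \<exists>s\<in>\<Gamma>. m s = g * ((t - a) / (b - a))" by force
  then obtain \<sigma> where \<sigma>: "\<And>t. t \<in> {a..b} \<Longrightarrow> \<sigma> t \<in> \<Gamma>"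
    "\<And>t. t \<in> {a..b} \<Longrightarrow> m (\<sigma> t) = g * ((t - a) / (b - a))"
    by metis
  have scale: "\<kappa> * x \<le> g * (x / (b - a))" if "x \<ge> 0" for x
    using mult_right_mono[OF g0(1) that] assms(1) by (simp add: field_simps)
  show ?thesis
  proof
    fix t assume t: "t \<in> {a..b}"
    then show "\<sigma> t \<in> \<Gamma>" by (rule \<sigma>)
    then have ab: "a \<le> \<sigma> t" "\<sigma> t \<le> b" using assms(3) by auto
    have "\<kappa> * (t - a) \<le> m (\<sigma> t)" unfolding \<sigma>(2)[OF t] using t by (intro scale) auto
    also have "\<dots> \<le> \<sigma> t - a" using m_lip[OF ab(1)] m_a by simp
    finally show "\<kappa> * (t - a) \<le> \<sigma> t - a" .
    have "\<kappa> * (b - t) \<le> g * ((b - t) / (b - a))" using t by (intro scale) auto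
    also have "\<dots> = m b - m (\<sigma> t)" unfolding \<sigma>(2)[OF t] m_b using assms(1) by (simp add: field_simps)
    also have "\<dots> \<le> b - \<sigma> t" using m_lip[OF ab(2)] .
    finally show "\<kappa> * (b - t) \<le> b - \<sigma> t" .
  next
    fix t t' assume t: "t \<in> {a..b}" "t' \<in> {a..b}" "t \<le> t'"
    show "\<kappa> * (t' - t) \<le> \<sigma> t' - \<sigma> t"
    proof (cases "t = t'")
      case False
      have diff: "m (\<sigma> t') - m (\<sigma> t) = g * ((t' - t) / (b - a))"
        unfolding \<sigma>(2)[OF t(1)] \<sigma>(2)[OF t(2)] by (simp flip: right_diff_distrib diff_divide_distrib)
      also have "\<dots> > 0" using t False assms(1) g0 by auto
      finally have "\<sigma> t \<le> \<sigma> t'" using m_mono[of "\<sigma> t'" "\<sigma> t"] by linarith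
      then have "m (\<sigma> t') - m (\<sigma> t) \<le> \<sigma> t' - \<sigma> t" by (rule m_lip)
      then show ?thesis using diff scale[of "t' - t"] t by simp
    qed simp
  qed
qed

section \<open>Chord lengths and maps of the circle\<close>

lemma cmod_cis_diff: "cmod (cis x - cis y) = 2 * \<bar>sin ((x - y) / 2)\<bar>"
proof -
  have "(cmod (cis x - cis y))\<^sup>2 = (cos x - cos y)\<^sup>2 + (sin x - sin y)\<^sup>2"
    by (simp add: cmod_power2)
  also have "\<dots> = 2 - 2 * cos (x - y)"
    using sin_cos_squared_add[of x] sin_cos_squared_add[of y]
    by (simp add: cos_diff power2_eq_square algebra_simps)
  also have "\<dots> = (2 * \<bar>sin ((x - y) / 2)\<bar>)\<^sup>2"
  proof -
    have "x - y = 2 * ((x - y) / 2)" by simp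
    then have "cos (x - y) = 1 - 2 * (sin ((x - y) / 2))\<^sup>2" by (metis cos_double_sin)
    then show ?thesis by (simp add: power_mult_distrib)
  qed
  finally show ?thesis by (rule power2_eq_imp_eq) auto
qed

text \<open>Concavity of the sine between 0 and \<open>\<kappa>\<close>-scaled \<open>x\<close>,
  using that the sine vanishes at 0.\<close>

lemma sin_scale_le:
  assumes "0 \<le> \<kappa>" "\<kappa> \<le> 1" "0 \<le> x" "x \<le> pi"
  shows "\<kappa> * sin x \<le> sin (\<kappa> * x)"
proof -
  have "concave_on {0..pi} sin"
    by (intro f''_le0_imp_concave[where f' = cos and f'' = "\<lambda>x. - sin x"])
       (auto intro!: derivative_eq_intros sin_ge_zero)
  from concave_onD[OF this, of \<kappa> 0 x] show ?thesis using assms by simp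
qed

text \<open>Here \<open>u\<close> and \<open>v\<close> are half the angular distances before and
  after a map. The sine increases only up to \<open>pi / 2\<close>, so beyond that point the
  complementary angles, measured the other way round the circle, are compared.\<close>

lemma sin_ge_of_contraction:
  assumes "0 \<le> \<kappa>" "\<kappa> \<le> 1" "0 \<le> u" "u \<le> pi" "\<kappa> * u \<le> v" "\<kappa> * (pi - u) \<le> pi - v"
  shows "\<kappa> * sin u \<le> sin v"
proof -
  have le1: "\<kappa> * u \<le> pi" "\<kappa> * (pi - u) \<le> pi" "0 \<le> \<kappa> * u" "0 \<le> \<kappa> * (pi - u)"
    using assms mult_mono[of \<kappa> 1 u pi] mult_mono[of \<kappa> 1 "pi - u" pi] by auto
  show ?thesis
  proof (cases "v \<le> pi / 2")
    case True
    have "\<kappa> * sin u \<le> sin (\<kappa> * u)" using assms by (intro sin_scale_le) auto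
    also have "\<dots> \<le> sin v" by (intro sin_monotone_2pi_le; use True assms le1 pi_gt_zero in linarith)
    finally show ?thesis .
  next
    case False
    have "\<kappa> * sin (pi - u) \<le> sin (\<kappa> * (pi - u))" using assms by (intro sin_scale_le) auto
    also have "\<dots> \<le> sin (pi - v)" by (intro sin_monotone_2pi_le; use False assms le1 pi_gt_zero in linarith)
    finally show ?thesis by simp
  qed
qed

lemma cis_angle_in_window:
  fixes a :: real
  assumes "cmod w = 1"
  obtains t where "t \<in> {a..a + 2 * pi}" "cis t = w"
proof -
  define k where "k = \<lfloor>(Arg w - a) / (2 * pi)\<rfloor>"
  define t where "t = Arg w - 2 * pi * k"
  have "w \<noteq> 0" using assms by auto
  have "cis t = cis (Arg w) * cis (2 * pi * (- k))" by (simp add: t_def cis_mult)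
  also have "cis (2 * pi * (- k)) = 1" by (rule cis_multiple_2pi) simp
  also have "cis (Arg w) = w" using cis_Arg[OF \<open>w \<noteq> 0\<close>] assms by (simp add: sgn_div_norm)
  finally have "cis t = w" by simp
  moreover have "t \<in> {a..a + 2 * pi}"
    using floor_correct[of "(Arg w - a) / (2 * pi)"] unfolding k_def[symmetric]
    by (auto simp: t_def field_simps)
  ultimately show ?thesis using that by blast
qed

text \<open>On the arc the map moves angles by the \<open>\<sigma>\<close> of
  \<open>compact_stretch\<close>; elsewhere it is the identity. Angular distances shrink by at most
  \<open>\<kappa>\<close> in both directions around the circle, and
  \<open>sin_ge_of_contraction\<close> turns this into a bound for chords.\<close>

lemma arc_stretch:
  fixes a b :: real
  assumes ab: "a < b" "b \<le> a + 2 * pi" and \<Gamma>: "compact \<Gamma>" "\<Gamma> \<subseteq> {a..b}"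
    and \<kappa>: "\<kappa> > 0" "\<kappa> \<le> 1" "measure lebesgue \<Gamma> \<ge> \<kappa> * (b - a)"
  obtains p where "p ` sphere 0 1 \<subseteq> sphere 0 1" "p ` closed_arc a b \<subseteq> cis ` \<Gamma>"
    "\<And>w. w \<notin> closed_arc a b \<Longrightarrow> p w = w"
    "\<And>w w'. w \<in> sphere 0 1 \<Longrightarrow> w' \<in> sphere 0 1 \<Longrightarrow> \<kappa> * cmod (w - w') \<le> cmod (p w - p w')"
proof -
  obtain \<sigma> where \<sigma>: "\<And>t. t \<in> {a..b} \<Longrightarrow> \<sigma> t \<in> \<Gamma>"
    "\<And>t. t \<in> {a..b} \<Longrightarrow> \<kappa> * (t - a) \<le> \<sigma> t - a"
    "\<And>t. t \<in> {a..b} \<Longrightarrow> \<kappa> * (b - t) \<le> b - \<sigma> t"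
    "\<And>t t'. t \<in> {a..b} \<Longrightarrow> t' \<in> {a..b} \<Longrightarrow> t \<le> t' \<Longrightarrow> \<kappa> * (t' - t) \<le> \<sigma> t' - \<sigma> t"
    by (rule compact_stretch[OF ab(1) \<Gamma> \<kappa>(1,3)]) blast
  \<comment> \<open>The window contains both ends of a full turn, so an angle need not be unique.
    For a point of the arc it is chosen in \<open>{a..b}\<close>, where \<open>\<sigma>\<close> is
    controlled.\<close>
  have "\<exists>t. t \<in> {a..a + 2 * pi} \<and> cis t = w \<and> (w \<in> closed_arc a b \<longrightarrow> t \<in> {a..b})"
    if "w \<in> sphere 0 1" for w
  proof (cases "w \<in> closed_arc a b")
    case True
    then show ?thesis using ab by (force simp: closed_arc_def)
  next
    case False
    then show ?thesis using cis_angle_in_window[of w a] that by (metis dist_0_norm mem_sphere)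
  qed
  then obtain \<theta> where \<theta>: "\<And>w. w \<in> sphere 0 1 \<Longrightarrow> \<theta> w \<in> {a..a + 2 * pi}"
    "\<And>w. w \<in> sphere 0 1 \<Longrightarrow> cis (\<theta> w) = w"
    "\<And>w. w \<in> sphere 0 1 \<Longrightarrow> w \<in> closed_arc a b \<Longrightarrow> \<theta> w \<in> {a..b}"
    by metis
  have arc_sphere: "closed_arc a b \<subseteq> sphere 0 1" by (auto simp: closed_arc_def)
  have off: "\<theta> w > b" if "w \<in> sphere 0 1" "w \<notin> closed_arc a b" for w
    using \<theta>(1)[OF that(1)] \<theta>(2)[OF that(1)] that(2) by (force simp: closed_arc_def)
  define s where "s w = (if w \<in> closed_arc a b then \<sigma> (\<theta> w) else \<theta> w)" for w
  define p where "p w = (if w \<in> closed_arc a b then cis (\<sigma> (\<theta> w)) else w)" for w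
  have p_s: "p w = cis (s w)" if "w \<in> sphere 0 1" for w
    using \<theta>(2)[OF that] by (simp add: p_def s_def)
  have scale: "\<kappa> * x \<le> x" if "x \<ge> 0" for x
    using mult_right_mono[OF \<kappa>(2) that] by simp
  \<comment> \<open>The fact \<open>mid\<close> controls the direct way between two points;
    \<open>lo\<close> and \<open>hi\<close> together control the way round through the cut at
    \<open>a\<close>.\<close>
  have lo: "\<kappa> * (\<theta> w - a) \<le> s w - a" if "w \<in> sphere 0 1" for w
    using \<theta>(1,3)[OF that] \<sigma>(2) scale[of "\<theta> w - a"] by (auto simp: s_def)
  have hi: "\<kappa> * (a + 2 * pi - \<theta> w) \<le> a + 2 * pi - s w" if "w \<in> sphere 0 1" for w
  proof (cases "w \<in> closed_arc a b")
    case True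
    have "\<kappa> * (a + 2 * pi - \<theta> w) = \<kappa> * (a + 2 * pi - b) + \<kappa> * (b - \<theta> w)" by (simp add: algebra_simps)
    also have "\<dots> \<le> (a + 2 * pi - b) + (b - \<sigma> (\<theta> w))"
      using \<sigma>(3)[OF \<theta>(3)[OF that True]] scale[of "a + 2 * pi - b"] ab by linarith
    finally show ?thesis using True by (simp add: s_def)
  next
    case False
    then show ?thesis using \<theta>(1)[OF that] scale[of "a + 2 * pi - \<theta> w"] by (simp add: s_def)
  qed
  have mid: "\<kappa> * (\<theta> w' - \<theta> w) \<le> s w' - s w"
    if w: "w \<in> sphere 0 1" "w' \<in> sphere 0 1" "\<theta> w \<le> \<theta> w'" for w w'
  proof (cases "w \<in> closed_arc a b")
    case True
    show ?thesis
    proof (cases "w' \<in> closed_arc a b")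
      case T2: True
      then show ?thesis using True \<sigma>(4) \<theta>(3) w by (simp add: s_def)
    next
      case False
      have "\<kappa> * (\<theta> w' - \<theta> w) = \<kappa> * (\<theta> w' - b) + \<kappa> * (b - \<theta> w)" by (simp add: algebra_simps)
      also have "\<dots> \<le> (\<theta> w' - b) + (b - \<sigma> (\<theta> w))"
        using \<sigma>(3)[OF \<theta>(3)[OF w(1) True]] scale[of "\<theta> w' - b"] off[OF w(2) False] by linarith
      finally show ?thesis using True False by (simp add: s_def)
    qed
  next
    case False
    then have "w' \<notin> closed_arc a b" using off[OF w(1) False] \<theta>(3)[OF w(2)] w(3) by force
    then show ?thesis using False scale[of "\<theta> w' - \<theta> w"] w(3) by (simp add: s_def)
  qed
  have main: "\<kappa> * cmod (w - w') \<le> cmod (p w - p w')"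
    if w: "w \<in> sphere 0 1" "w' \<in> sphere 0 1" "\<theta> w \<le> \<theta> w'" for w w'
  proof -
    have u: "0 \<le> (\<theta> w' - \<theta> w) / 2" "(\<theta> w' - \<theta> w) / 2 \<le> pi"
      using \<theta>(1)[OF w(1)] \<theta>(1)[OF w(2)] w(3) by auto
    have "\<kappa> * sin ((\<theta> w' - \<theta> w) / 2) \<le> sin ((s w' - s w) / 2)"
    proof (rule sin_ge_of_contraction)
      show "\<kappa> * ((\<theta> w' - \<theta> w) / 2) \<le> (s w' - s w) / 2" using mid[OF w] by simp
      have "\<kappa> * (pi - (\<theta> w' - \<theta> w) / 2) = (\<kappa> * (a + 2 * pi - \<theta> w') + \<kappa> * (\<theta> w - a)) / 2"
        by (simp add: field_simps)
      also have "\<dots> \<le> ((a + 2 * pi - s w') + (s w - a)) / 2"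
        using hi[OF w(2)] lo[OF w(1)] by (intro divide_right_mono add_mono) auto
      also have "\<dots> = pi - (s w' - s w) / 2" by (simp add: field_simps)
      finally show "\<kappa> * (pi - (\<theta> w' - \<theta> w) / 2) \<le> pi - (s w' - s w) / 2" .
    qed (use \<kappa> u in auto)
    moreover have "sin ((\<theta> w' - \<theta> w) / 2) \<ge> 0" using u by (intro sin_ge_zero) auto
    ultimately have "\<kappa> * cmod (cis (\<theta> w') - cis (\<theta> w)) \<le> cmod (cis (s w') - cis (s w))"
      unfolding cmod_cis_diff by simp
    then show ?thesis
      using \<theta>(2) p_s w by (simp add: norm_minus_commute)
  qed
  show ?thesis
  proof
    show "p ` sphere 0 1 \<subseteq> sphere 0 1" using p_s by auto
    show "p ` closed_arc a b \<subseteq> cis ` \<Gamma>" using \<sigma>(1) \<theta>(3) arc_sphere by (auto simp: p_def)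
    show "p w = w" if "w \<notin> closed_arc a b" for w using that by (simp add: p_def)
    show "\<kappa> * cmod (w - w') \<le> cmod (p w - p w')" if "w \<in> sphere 0 1" "w' \<in> sphere 0 1" for w w'
      using main[OF that] main[OF that(2,1)] by (cases "\<theta> w \<le> \<theta> w'") (auto simp: norm_minus_commute)
  qed
qed

text \<open>
  The arcs may overlap: a point that has already been moved into \<open>G\<close> stays in \<open>G\<close>, since the map of
  the next arc either fixes it or sends it into \<open>G\<close> again.
\<close>

lemma arcs_stretch:
  fixes A :: "(real \<times> real) set"
  assumes "finite A" and G: "G \<subseteq> sphere 0 1" and \<kappa>: "\<kappa> > 0" "\<kappa> \<le> 1"
    and A: "\<And>a b. (a, b) \<in> A \<Longrightarrow> a < b \<and> b \<le> a + 2 * pi \<and>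
      (\<exists>\<Gamma>. compact \<Gamma> \<and> \<Gamma> \<subseteq> {a..b} \<and> cis ` \<Gamma> \<subseteq> G \<and> measure lebesgue \<Gamma> \<ge> \<kappa> * (b - a))"
  shows "\<exists>p. p ` sphere 0 1 \<subseteq> sphere 0 1 \<and> p ` (\<Union>(a,b)\<in>A. closed_arc a b) \<subseteq> G \<and>
      (\<forall>w. p w = w \<or> p w \<in> G) \<and>
      (\<forall>w\<in>sphere 0 1. \<forall>w'\<in>sphere 0 1. \<kappa> ^ card A * cmod (w - w') \<le> cmod (p w - p w'))"
  using assms(1) A
proof (induction A rule: finite_induct)
  case empty
  show ?case by (rule exI[of _ id]) auto
next
  case (insert x A)
  obtain a b where x: "x = (a, b)" by (cases x)
  obtain p where p: "p ` sphere 0 1 \<subseteq> sphere 0 1" "p ` (\<Union>(a,b)\<in>A. closed_arc a b) \<subseteq> G"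
      "\<And>w. p w = w \<or> p w \<in> G"
      "\<And>w w'. w \<in> sphere 0 1 \<Longrightarrow> w' \<in> sphere 0 1 \<Longrightarrow> \<kappa> ^ card A * cmod (w - w') \<le> cmod (p w - p w')"
    using insert.IH insert.prems by (metis (no_types, lifting) insertCI)
  obtain \<Gamma> where ab: "a < b" "b \<le> a + 2 * pi"
    and \<Gamma>: "compact \<Gamma>" "\<Gamma> \<subseteq> {a..b}" "cis ` \<Gamma> \<subseteq> G" "measure lebesgue \<Gamma> \<ge> \<kappa> * (b - a)"
    using insert.prems[of a b] x by auto
  obtain q where q: "q ` sphere 0 1 \<subseteq> sphere 0 1" "q ` closed_arc a b \<subseteq> cis ` \<Gamma>"
    "\<And>w. w \<notin> closed_arc a b \<Longrightarrow> q w = w"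
    "\<And>w w'. w \<in> sphere 0 1 \<Longrightarrow> w' \<in> sphere 0 1 \<Longrightarrow> \<kappa> * cmod (w - w') \<le> cmod (q w - q w')"
    using arc_stretch[OF ab \<Gamma>(1,2) \<kappa> \<Gamma>(4)] by blast
  have qG: "q w \<in> G" if "w \<in> G \<or> w \<in> closed_arc a b" for w
    using that q(2) q(3)[of w] \<Gamma>(3) by (cases "w \<in> closed_arc a b") auto
  have q_or: "q w = w \<or> q w \<in> G" for w
    using qG[of w] q(3)[of w] by blast
  show ?case
  proof (intro exI[of _ "q \<circ> p"] conjI ballI allI)
    show "(q \<circ> p) ` sphere 0 1 \<subseteq> sphere 0 1" using p(1) q(1) by fastforce
    show "(q \<circ> p) ` (\<Union>(a,b)\<in>insert x A. closed_arc a b) \<subseteq> G"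
    proof (intro image_subsetI)
      fix w assume "w \<in> (\<Union>(a,b)\<in>insert x A. closed_arc a b)"
      then consider "w \<in> closed_arc a b" | "w \<in> (\<Union>(a,b)\<in>A. closed_arc a b)" using x by auto
      then show "(q \<circ> p) w \<in> G"
      proof cases
        case 1
        then have "p w \<in> G \<or> p w \<in> closed_arc a b" using p(3)[of w] by auto
        then show ?thesis using qG by simp
      next
        case 2
        then have "p w \<in> G" using p(2) by blast
        then show ?thesis using qG by simp
      qed
    qed
    show "(q \<circ> p) w = w \<or> (q \<circ> p) w \<in> G" for w
      using p(3)[of w] q_or[of "p w"] qG[of "p w"] by auto
    fix w w' :: complex assume w: "w \<in> sphere 0 1" "w' \<in> sphere 0 1"
    have "\<kappa> ^ card (insert x A) * cmod (w - w') = \<kappa> * (\<kappa> ^ card A * cmod (w - w'))"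
      using insert.hyps by simp
    also have "\<dots> \<le> \<kappa> * cmod (p w - p w')" using p(4)[OF w] \<kappa> by (intro mult_left_mono) auto
    also have "\<dots> \<le> cmod ((q \<circ> p) w - (q \<circ> p) w')"
    proof -
      have "p w \<in> sphere 0 1" "p w' \<in> sphere 0 1" using p(1) w by blast+
      then show ?thesis using q(4) by simp
    qed
    finally show "\<kappa> ^ card (insert x A) * cmod (w - w') \<le> cmod ((q \<circ> p) w - (q \<circ> p) w')" .
  qed
qed

section \<open>Arcs, measure and prediction polynomials\<close>

lemma closed_arc_shift: "closed_arc (a - 2 * pi * of_int k) (b - 2 * pi * of_int k) = closed_arc a b"
proof -
  have per: "cis (x - 2 * pi * of_int k) = cis x" for x
  proof -
    have "cis (x - 2 * pi * of_int k) = cis x * cis (2 * pi * of_int (- k))" by (simp add: cis_mult)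
    then show ?thesis by (subst (asm) cis_multiple_2pi) auto
  qed
  have "{a - 2 * pi * of_int k..b - 2 * pi * of_int k} = (\<lambda>x. x - 2 * pi * of_int k) ` {a..b}"
    using image_add_atLeastAtMost[of "- 2 * pi * of_int k" a b] by simp
  then show ?thesis by (simp only: closed_arc_def image_image per)
qed

lemma closed_arc_full:
  assumes "b \<ge> a + 2 * pi"
  shows "closed_arc a b = sphere 0 1"
proof
  show "closed_arc a b \<subseteq> sphere 0 1" by (auto simp: closed_arc_def)
  show "sphere 0 1 \<subseteq> closed_arc a b"
  proof
    fix w :: complex assume "w \<in> sphere 0 1"
    then obtain t where "t \<in> {a..a + 2 * pi}" "cis t = w"
      using cis_angle_in_window[of w a] by auto
    then show "w \<in> closed_arc a b" using assms by (auto simp: closed_arc_def)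
  qed
qed

text \<open>An arc of at least a full turn is the whole circle. A shorter one is shifted so that it
  starts in \<open>{-pi..<pi}\<close>; if it extends beyond \<open>pi\<close>, it is cut there and
  the rest is shifted back by a full turn.\<close>

lemma closed_arc_normalize:
  assumes "a < b"
  shows "\<exists>B. finite B \<and> (\<forall>(c,d)\<in>B. -pi \<le> c \<and> c < d \<and> d \<le> pi) \<and>
    closed_arc a b = (\<Union>(c,d)\<in>B. closed_arc c d)"
proof (cases "b \<ge> a + 2 * pi")
  case True
  then have "closed_arc a b = closed_arc (-pi) pi"
    using closed_arc_full[OF True] closed_arc_full[of "-pi" pi] by simp
  then show ?thesis by (intro exI[of _ "{(-pi, pi)}"]) auto
next
  case False
  define k where "k = \<lfloor>(a + pi) / (2 * pi)\<rfloor>"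
  define a' where "a' = a - 2 * pi * of_int k"
  define b' where "b' = b - 2 * pi * of_int k"
  have eq: "closed_arc a b = closed_arc a' b'"
    unfolding a'_def b'_def by (rule closed_arc_shift[symmetric])
  have a': "-pi \<le> a'" "a' < pi"
    using floor_correct[of "(a + pi) / (2 * pi)"] unfolding k_def[symmetric] a'_def
    by (auto simp: field_simps)
  have b': "a' < b'" "b' < a' + 2 * pi" using assms False by (auto simp: a'_def b'_def)
  show ?thesis
  proof (cases "b' \<le> pi")
    case True
    then show ?thesis using a' b' eq by (intro exI[of _ "{(a', b')}"]) auto
  next
    case False
    have "{a'..b'} = {a'..pi} \<union> {pi..b'}" using a' False by auto
    then have "closed_arc a' b' = closed_arc a' pi \<union> closed_arc pi b'"
      by (simp add: closed_arc_def image_Un)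
    also have "closed_arc pi b' = closed_arc (-pi) (b' - 2 * pi)"
      using closed_arc_shift[of pi 1 b'] by simp
    finally show ?thesis
      using a' b' eq False by (intro exI[of _ "{(a', pi), (-pi, b' - 2 * pi)}"]) auto
  qed
qed

lemma arcs_normalize:
  fixes A :: "(real \<times> real) set"
  assumes "finite A" "\<forall>(a,b)\<in>A. a < b"
  obtains B where "finite B" "\<And>c d. (c, d) \<in> B \<Longrightarrow> -pi \<le> c \<and> c < d \<and> d \<le> pi"
    "(\<Union>(a,b)\<in>A. closed_arc a b) = (\<Union>(c,d)\<in>B. closed_arc c d)"
proof -
  have "\<forall>x\<in>A. \<exists>B. finite B \<and> (\<forall>(c,d)\<in>B. -pi \<le> c \<and> c < d \<and> d \<le> pi) \<and>
    (case x of (a, b) \<Rightarrow> closed_arc a b) = (\<Union>(c,d)\<in>B. closed_arc c d)"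
  proof
    fix x assume "x \<in> A"
    moreover obtain a b where x: "x = (a, b)" by (cases x)
    ultimately have "a < b" using assms(2) by blast
    from closed_arc_normalize[OF this] show "\<exists>B. finite B \<and> (\<forall>(c,d)\<in>B. -pi \<le> c \<and> c < d \<and> d \<le> pi) \<and>
        (case x of (a, b) \<Rightarrow> closed_arc a b) = (\<Union>(c,d)\<in>B. closed_arc c d)"
      unfolding x by simp
  qed
  from bchoice[OF this] obtain B where
    B_all: "\<forall>x\<in>A. finite (B x) \<and> (\<forall>(c,d)\<in>B x. -pi \<le> c \<and> c < d \<and> d \<le> pi) \<and>
      (case x of (a, b) \<Rightarrow> closed_arc a b) = (\<Union>(c,d)\<in>B x. closed_arc c d)" ..
  note B = bspec[OF B_all, THEN conjunct1] bspec[OF B_all, THEN conjunct2, THEN conjunct1]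
    bspec[OF B_all, THEN conjunct2, THEN conjunct2]
  show ?thesis
  proof
    show "finite (\<Union>x\<in>A. B x)" using B(1) assms(1) by blast
    show "-pi \<le> c \<and> c < d \<and> d \<le> pi" if "(c, d) \<in> (\<Union>x\<in>A. B x)" for c d
      using that B(2) by blast
    show "(\<Union>(a,b)\<in>A. closed_arc a b) = (\<Union>(c,d)\<in>(\<Union>x\<in>A. B x). closed_arc c d)"
      using B(3) by (simp add: SUP_UNION)
  qed
qed

text \<open>The sets where \<open>f\<close> is at most \<open>1 / real (Suc k)\<close> decrease to a
  null set, so their measures tend to 0. This gives a uniform lower bound for \<open>f\<close> off a
  set of small measure.\<close>

lemma compact_superlevel_set:
  fixes f :: "real \<Rightarrow> real"
  assumes "compact J" "J \<subseteq> S" "S \<in> sets lebesgue" "f \<in> borel_measurable (lebesgue_on S)"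
    and pos: "AE l in lebesgue. l \<in> J \<longrightarrow> f l > 0" and "\<delta> > 0"
  obtains \<eta> C where "\<eta> > 0" "compact C" "C \<subseteq> J" "\<And>l. l \<in> C \<Longrightarrow> f l > \<eta>" "measure lebesgue (J - C) < \<delta>"
proof -
  have J: "J \<in> lmeasurable" using assms(1) by (rule lmeasurable_compact)
  define N where "N k = {l \<in> J. f l \<le> 1 / real (Suc k)}" for k
  have N: "N k \<in> lmeasurable" for k
  proof -
    have "{l \<in> space (lebesgue_on S). f l \<le> 1 / real (Suc k)} \<in> sets (lebesgue_on S)"
      using assms(4) by measurable
    then have "{l \<in> S. f l \<le> 1 / real (Suc k)} \<in> sets lebesgue"
      using assms(3) by (simp add: sets_restrict_space_iff)
    then have "J \<inter> {l \<in> S. f l \<le> 1 / real (Suc k)} \<in> lmeasurable"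
      using J by (intro fmeasurable_Int_fmeasurable)
    moreover have "J \<inter> {l \<in> S. f l \<le> 1 / real (Suc k)} = N k" using assms(2) by (auto simp: N_def)
    ultimately show ?thesis by simp
  qed
  have "(\<lambda>k. measure lebesgue (N k)) \<longlonglongrightarrow> measure lebesgue (\<Inter>k. N k)"
  proof (rule Lim_measure_decseq)
    show "range N \<subseteq> sets lebesgue" using N by (auto intro: fmeasurableD)
    show "decseq N"
    proof (rule decseq_SucI, rule subsetI)
      fix k l assume "l \<in> N (Suc k)"
      then have "l \<in> J" "f l \<le> 1 / real (Suc (Suc k))" by (auto simp: N_def)
      moreover have "1 / real (Suc (Suc k)) \<le> 1 / real (Suc k)" by (simp add: field_simps)
      ultimately show "l \<in> N k" unfolding N_def by (auto intro: order.trans)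
    qed
    show "emeasure lebesgue (N i) \<noteq> \<infinity>" for i using fmeasurableD2[OF N] by simp
  qed
  moreover have "measure lebesgue (\<Inter>k. N k) = 0"
  proof (rule measure_eq_0_null_sets)
    have "AE l in lebesgue. l \<notin> (\<Inter>k. N k)"
      using pos
    proof eventually_elim
      case (elim l)
      show ?case
      proof
        assume l: "l \<in> (\<Inter>k. N k)"
        then have "f l > 0" using elim by (auto simp: N_def)
        then obtain k where "1 / real (Suc k) < f l" by (metis nat_approx_posE)
        moreover have "f l \<le> 1 / real (Suc k)" using l by (simp add: N_def)
        ultimately show False by simp
      qed
    qed
    moreover have "(\<Inter>k. N k) \<in> sets lebesgue"
      using N by (intro sets.countable_INT) (auto intro: fmeasurableD)
    ultimately show "(\<Inter>k. N k) \<in> null_sets lebesgue" by (simp add: AE_iff_null_sets)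
  qed
  ultimately have "(\<lambda>k. measure lebesgue (N k)) \<longlonglongrightarrow> 0" by simp
  then have "\<forall>\<^sub>F k in sequentially. measure lebesgue (N k) < \<delta> / 2"
    using assms(6) by (intro order_tendstoD(2)) auto
  then obtain k where k: "measure lebesgue (N k) < \<delta> / 2"
    by (auto simp: eventually_sequentially)
  \<comment> \<open>Half of \<open>\<delta>\<close> pays for \<open>N k\<close>, the other half for
    passing to a closed subset by inner regularity. That subset is compact because it lies in
    \<open>J\<close>.\<close>
  have E: "J - N k \<in> sets lebesgue" using J N by (auto intro: fmeasurableD)
  obtain C where C: "closed C" "C \<subseteq> J - N k" "(J - N k) - C \<in> lmeasurable"
      "emeasure lebesgue ((J - N k) - C) < ennreal (\<delta> / 2)"
    using sets_lebesgue_inner_closed[OF E, of "\<delta> / 2"] assms(6) by auto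
  show ?thesis
  proof
    show "(1::real) / real (Suc k) > 0" by simp
    show "compact C" using compact_Int_closed[OF assms(1) C(1)] C(2)
      by (metis Diff_subset inf.absorb2 order.trans)
    show "C \<subseteq> J" using C(2) by auto
    show "f l > 1 / real (Suc k)" if "l \<in> C" for l using that C(2) by (auto simp: N_def)
    have "measure lebesgue ((J - N k) - C) < \<delta> / 2"
      using C(3,4) assms(6) by (simp add: emeasure_eq_measure2 ennreal_less_iff)
    moreover have "J - C \<subseteq> N k \<union> ((J - N k) - C)" by auto
    then have "measure lebesgue (J - C) \<le> measure lebesgue (N k \<union> ((J - N k) - C))"
      using N C(1,3) J by (intro measure_mono_fmeasurable fmeasurable.Un) (auto intro: fmeasurableD)
    moreover have "measure lebesgue (N k \<union> ((J - N k) - C)) \<le> measure lebesgue (N k) + measure lebesgue ((J - N k) - C)"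
      using N C(3) by (intro measure_Un_le) (auto intro: fmeasurableD)
    ultimately show "measure lebesgue (J - C) < \<delta>" using k by simp
  qed
qed

section \<open>Prediction errors as weighted norms of monic polynomials\<close>

lemma monic_poly_of_prediction:
  fixes c :: "nat \<Rightarrow> complex"
  obtains Q where "degree Q = n" "lead_coeff Q = 1"
    "\<And>l. cmod (1 - (\<Sum>k=1..n. c k * cis (- (real k * l)))) = cmod (poly Q (cis l))"
proof -
  \<comment> \<open>Multiplication by \<open>cis (real n * l)\<close>, which has modulus 1, turns
    the frequency \<open>- k\<close> into the power \<open>n - k\<close>; the coefficients therefore
    appear in reverse order.\<close>
  define R where "R = (\<Sum>k=1..n. monom (c k) (n - k))"
  define Q where "Q = monom 1 n - R"
  have coeff_R: "coeff R m = 0" if "m \<ge> n" for m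
    unfolding R_def coeff_sum using that by (intro sum.neutral) (auto simp: coeff_monom)
  have "coeff Q n = 1" by (simp add: Q_def coeff_R)
  moreover have "degree Q = n"
  proof (rule antisym)
    show "degree Q \<le> n" by (rule degree_le) (auto simp: Q_def coeff_R)
    show "n \<le> degree Q" using \<open>coeff Q n = 1\<close> by (intro le_degree) simp
  qed
  moreover have "cmod (1 - (\<Sum>k=1..n. c k * cis (- (real k * l)))) = cmod (poly Q (cis l))" for l
  proof -
    have "poly Q (cis l) = cis (real n * l) - (\<Sum>k=1..n. c k * cis (real (n - k) * l))"
      by (simp add: Q_def R_def poly_monom poly_sum Complex.DeMoivre)
    also have "(\<Sum>k=1..n. c k * cis (real (n - k) * l))
        = (\<Sum>k=1..n. cis (real n * l) * (c k * cis (- (real k * l))))"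
      by (intro sum.cong refl) (auto simp: cis_mult of_nat_diff algebra_simps)
    also have "cis (real n * l) - \<dots> = cis (real n * l) * (1 - (\<Sum>k=1..n. c k * cis (- (real k * l))))"
      by (simp add: sum_distrib_left algebra_simps)
    finally show ?thesis by (simp add: norm_mult)
  qed
  ultimately show ?thesis using that by blast
qed

lemma prediction_of_monic_poly:
  fixes Q :: "complex poly"
  assumes "degree Q = n" "lead_coeff Q = 1"
  obtains c :: "nat \<Rightarrow> complex" where
    "\<And>l. cmod (1 - (\<Sum>k=1..n. c k * cis (- (real k * l)))) = cmod (poly Q (cis l))"
proof -
  \<comment> \<open>The same reversal read backwards; the leading coefficient 1 becomes the constant
    term.\<close>
  define c where "c k = - coeff Q (n - k)" for k
  have "cmod (1 - (\<Sum>k=1..n. c k * cis (- (real k * l)))) = cmod (poly Q (cis l))" for l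
  proof -
    have "poly Q (cis l) = (\<Sum>i\<le>n. coeff Q i * cis (real i * l))"
      by (simp add: poly_altdef assms(1) Complex.DeMoivre)
    also have "\<dots> = (\<Sum>k\<le>n. coeff Q (n - k) * cis (real (n - k) * l))"
      by (rule sum.nat_diff_reindex[where n = "Suc n", unfolded lessThan_Suc_atMost, simplified, symmetric])
    also have "\<dots> = (\<Sum>k=0..n. cis (real n * l) * (coeff Q (n - k) * cis (- (real k * l))))"
      unfolding atMost_atLeast0
      by (intro sum.cong refl) (auto simp: cis_mult of_nat_diff algebra_simps)
    also have "\<dots> = cis (real n * l) * (coeff Q n + (\<Sum>k=1..n. coeff Q (n - k) * cis (- (real k * l))))"
      by (simp add: sum.atLeast_Suc_atMost sum_distrib_left algebra_simps)
    also have "coeff Q n + (\<Sum>k=1..n. coeff Q (n - k) * cis (- (real k * l)))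
        = 1 - (\<Sum>k=1..n. c k * cis (- (real k * l)))"
      using assms by (simp add: c_def sum_negf)
    finally show ?thesis by (simp add: norm_mult)
  qed
  then show ?thesis using that by blast
qed

context
  fixes f :: "real \<Rightarrow> real"
  assumes f: "spectral_density f"
begin

text \<open>Nonnegativity upgrades integrability of \<open>f\<close> to absolute integrability,
  which survives multiplication by a bounded measurable factor.\<close>

lemma integrable_poly_weight: "(\<lambda>l. (cmod (poly Q (cis l)))\<^sup>2 * f l) integrable_on {-pi..pi}"
proof -
  have cont: "continuous_on {-pi..pi} (\<lambda>l. (cmod (poly Q (cis l)))\<^sup>2)"
    by (intro continuous_intros)
  have "(\<lambda>l. (cmod (poly Q (cis l)))\<^sup>2 * f l) absolutely_integrable_on {-pi..pi}"
  proof (rule absolutely_integrable_bounded_measurable_product_real)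
    show "(\<lambda>l. (cmod (poly Q (cis l)))\<^sup>2) \<in> borel_measurable (lebesgue_on {-pi..pi})"
      using cont by (intro continuous_imp_measurable_on_sets_lebesgue) auto
    show "bounded ((\<lambda>l. (cmod (poly Q (cis l)))\<^sup>2) ` {-pi..pi})"
      using compact_continuous_image[OF cont] compact_imp_bounded by blast
    show "f absolutely_integrable_on {-pi..pi}"
      using f by (intro nonnegative_absolutely_integrable_1) (auto simp: spectral_density_def)
  qed simp
  then show ?thesis by (rule set_lebesgue_integral_eq_integral(1))
qed

lemma integral_poly_weight_nonneg: "integral {-pi..pi} (\<lambda>l. (cmod (poly Q (cis l)))\<^sup>2 * f l) \<ge> 0"
  using f by (intro integral_nonneg integrable_poly_weight) (auto simp: spectral_density_def)

lemma pred_error_sq_ge: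
  assumes "\<And>Q. degree Q = n \<Longrightarrow> lead_coeff Q = 1 \<Longrightarrow>
    x \<le> integral {-pi..pi} (\<lambda>l. (cmod (poly Q (cis l)))\<^sup>2 * f l)"
  shows "x \<le> pred_error_sq n f"
  unfolding pred_error_sq_def
proof (rule cINF_greatest)
  fix c :: "nat \<Rightarrow> complex"
  obtain Q where Q: "degree Q = n" "lead_coeff Q = 1"
    "\<And>l. cmod (1 - (\<Sum>k=1..n. c k * cis (- (real k * l)))) = cmod (poly Q (cis l))"
    using monic_poly_of_prediction[of n c] by blast
  show "x \<le> integral {-pi..pi} (\<lambda>l. (cmod (1 - (\<Sum>k=1..n. c k * cis (- (real k * l)))))\<^sup>2 * f l)"
    unfolding Q(3) by (rule assms[OF Q(1,2)])
qed simp

lemma pred_error_sq_le: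
  assumes "degree Q = n" "lead_coeff Q = 1"
  shows "pred_error_sq n f \<le> integral {-pi..pi} (\<lambda>l. (cmod (poly Q (cis l)))\<^sup>2 * f l)"
proof -
  obtain c where c: "\<And>l. cmod (1 - (\<Sum>k=1..n. c k * cis (- (real k * l)))) = cmod (poly Q (cis l))"
    using prediction_of_monic_poly[OF assms] by blast
  show ?thesis
    unfolding pred_error_sq_def c[symmetric]
  \<comment> \<open>A real infimum lies below its members once they have a common lower bound; 0 is
    one.\<close>
  proof (rule cINF_lower)
    show "bdd_below (range (\<lambda>c::nat \<Rightarrow> complex.
     integral {-pi..pi} (\<lambda>l. (cmod (1 - (\<Sum>k=1..n. c k * cis (- (real k * l)))))\<^sup>2 * f l)))"
    proof (rule bdd_belowI2)
      fix c :: "nat \<Rightarrow> complex"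
      obtain Q where "\<And>l. cmod (1 - (\<Sum>k=1..n. c k * cis (- (real k * l)))) = cmod (poly Q (cis l))"
        using monic_poly_of_prediction[of n c] by blast
      then show "0 \<le> integral {-pi..pi} (\<lambda>l. (cmod (1 - (\<Sum>k=1..n. c k * cis (- (real k * l)))))\<^sup>2 * f l)"
        by (simp add: integral_poly_weight_nonneg)
    qed
  qed simp
qed

lemma pred_error_sq_nonneg: "pred_error_sq n f \<ge> 0"
  by (rule pred_error_sq_ge) (rule integral_poly_weight_nonneg)

end

section \<open>Bounds for the prediction error\<close>

text \<open>Markov's inequality for the gauge integral: \<open>y\<close> times the indicator of
  \<open>D\<close> lies below \<open>g\<close> extended by 0.\<close>

lemma measure_superlevel_le_integral:
  fixes g :: "real \<Rightarrow> real"
  assumes "g integrable_on S" "\<And>l. l \<in> S \<Longrightarrow> g l \<ge> 0"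
    and "D \<in> lmeasurable" "D \<subseteq> S" "\<And>l. l \<in> D \<Longrightarrow> g l \<ge> y"
  shows "y * measure lebesgue D \<le> integral S g"
proof -
  have "(indicator D has_integral measure lebesgue D) UNIV"
    using assms(3) by (simp add: lmeasurable_iff_has_integral)
  then have "((\<lambda>l. y * indicator D l) has_integral y * measure lebesgue D) UNIV"
    by (rule has_integral_mult_right)
  moreover have "((\<lambda>l. if l \<in> S then g l else 0) has_integral integral S g) UNIV"
    using assms(1) by (simp add: has_integral_restrict_UNIV integrable_integral)
  ultimately show ?thesis
    by (rule has_integral_le) (use assms in \<open>auto simp: indicator_def\<close>)
qed

text \<open>For fixed \<open>\<kappa>\<close> the constant \<open>c\<close> depends neither on
  \<open>n\<close> nor on the polynomial, so it disappears under the \<open>n\<close>-th root.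
  Outside two sets of measure less than \<open>\<delta>\<close>, both \<open>f\<close> is bounded
  below and the polynomial is bounded above; the rest of every arc is large enough for
  \<open>arcs_stretch\<close>.\<close>

lemma pred_error_sq_lower_bound:
  fixes f :: "real \<Rightarrow> real" and B :: "(real \<times> real) set"
  assumes f: "spectral_density f" and B: "finite B" "B \<noteq> {}"
    "\<And>c d. (c, d) \<in> B \<Longrightarrow> -pi \<le> c \<and> c < d \<and> d \<le> pi"
    and K: "K = (\<Union>(c,d)\<in>B. closed_arc c d)" "infinite K"
    and pos: "AE l in lebesgue. l \<in> {-pi..pi} \<and> cis l \<in> K \<longrightarrow> f l > 0"
    and \<kappa>: "0 < \<kappa>" "\<kappa> < 1"
  obtains c where "c > 0"
    "\<And>n. n > 0 \<Longrightarrow> c * (\<kappa> ^ card B * transfinite_diameter K) ^ (2 * n) \<le> pred_error_sq n f"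
proof -
  define m where "m = Min ((\<lambda>(c,d). d - c) ` B)"
  have m: "m \<le> d - c" if "(c, d) \<in> B" for c d
    unfolding m_def using that B(1) by (intro Min_le) force+
  have "m > 0" unfolding m_def using B by (subst Min_gr_iff) force+
  \<comment> \<open>With \<open>m\<close> the shortest arc length, two exceptional sets of measure
    below \<open>\<delta>\<close> leave at least the fraction \<open>\<kappa>\<close> of every
    arc.\<close>
  define \<delta> where "\<delta> = (1 - \<kappa>) * m / 2"
  have \<delta>: "\<delta> > 0" "2 * \<delta> \<le> (1 - \<kappa>) * (d - c)" if "(c, d) \<in> B" for c d
    using \<kappa> \<open>m > 0\<close> m[OF that] by (auto simp: \<delta>_def)
  then have \<delta>0: "\<delta> > 0" using B(2) by auto
  define J where "J = (\<Union>(c,d)\<in>B. {c..d})"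
  have J: "compact J" unfolding J_def using B(1) by (intro compact_UN) auto
  have J_sub: "J \<subseteq> {-pi..pi}" unfolding J_def using B(3) by fastforce
  have J_K: "cis l \<in> K" if "l \<in> J" for l
    using that unfolding J_def K closed_arc_def by auto
  have pos_J: "AE l in lebesgue. l \<in> J \<longrightarrow> f l > 0"
    using pos by eventually_elim (use J_sub J_K in blast)
  have "f integrable_on {-pi..pi}" using f by (simp add: spectral_density_def)
  then have meas: "f \<in> borel_measurable (lebesgue_on {-pi..pi})" by (rule integrable_imp_measurable)
  obtain \<eta> C where C: "\<eta> > 0" "compact C" "C \<subseteq> J" "\<And>l. l \<in> C \<Longrightarrow> f l > \<eta>" "measure lebesgue (J - C) < \<delta>"
    using compact_superlevel_set[OF J J_sub _ meas pos_J \<delta>0] by auto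
  have K_sphere: "K \<subseteq> sphere 0 1" by (auto simp: K closed_arc_def)
  have "\<delta> * \<eta> * (\<kappa> ^ card B * transfinite_diameter K) ^ (2 * n) \<le> pred_error_sq n f" if n: "n > 0" for n
  proof (rule pred_error_sq_ge[OF f])
    fix Q :: "complex poly" assume Q: "degree Q = n" "lead_coeff Q = 1"
    define g where "g l = (cmod (poly Q (cis l)))\<^sup>2" for l
    define I where "I = integral {-pi..pi} (\<lambda>l. g l * f l)"
    have "I \<ge> 0" unfolding I_def g_def by (rule integral_poly_weight_nonneg[OF f])
    have "\<delta> * \<eta> * (\<kappa> ^ card B * transfinite_diameter K) ^ (2 * n) \<le> I"
    proof (rule field_le_epsilon)
      fix e :: real assume "e > 0"
      \<comment> \<open>Enlarging \<open>I\<close> gives a positive threshold and a strict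
        inequality for the measure of \<open>D\<close>, even if \<open>I\<close> is 0.\<close>
      define X where "X = I + e"
      have X: "X > 0" "I < X" using \<open>I \<ge> 0\<close> \<open>e > 0\<close> by (auto simp: X_def)
      \<comment> \<open>On \<open>D\<close> the integrand is at least \<open>Y * \<eta>\<close>,
        which equals \<open>X / \<delta>\<close>, so Markov's inequality forces the measure of
        \<open>D\<close> below \<open>\<delta>\<close>.\<close>
      define Y where "Y = X / (\<delta> * \<eta>)"
      have Y: "Y > 0" using X \<delta>0 C by (simp add: Y_def)
      define G where "G = {l \<in> C. g l \<le> Y}"
      define D where "D = {l \<in> C. g l > Y}"
      have cont: "continuous_on C g" unfolding g_def by (intro continuous_intros)
      have "closed (C \<inter> g -` {..Y})"
        using cont compact_imp_closed[OF C(2)] by (intro continuous_closed_preimage) auto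
      then have "compact (C \<inter> (C \<inter> g -` {..Y}))" by (rule compact_Int_closed[OF C(2)])
      moreover have "C \<inter> (C \<inter> g -` {..Y}) = G" by (auto simp: G_def)
      ultimately have G: "compact G" by simp
      have D_eq: "D = C - G" by (auto simp: D_def G_def)
      have D_meas: "D \<in> lmeasurable"
        unfolding D_eq using C(2) G by (intro fmeasurable.Diff lmeasurable_compact)
      have "X / \<delta> * measure lebesgue D \<le> I"
        unfolding I_def
      proof (rule measure_superlevel_le_integral[OF _ _ D_meas])
        show "(\<lambda>l. g l * f l) integrable_on {-pi..pi}"
          unfolding g_def by (rule integrable_poly_weight[OF f])
        show "g l * f l \<ge> 0" if "l \<in> {-pi..pi}" for l
          using that f by (simp add: g_def spectral_density_def)
        show "D \<subseteq> {-pi..pi}" using C(3) J_sub by (auto simp: D_def)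
        fix l assume "l \<in> D"
        then have "Y \<le> g l" "\<eta> \<le> f l" using C(4) by (auto simp: D_def intro: less_imp_le)
        then have "Y * \<eta> \<le> g l * f l" using Y C(1) by (intro mult_mono) (auto simp: g_def)
        then show "X / \<delta> \<le> g l * f l" using C(1) \<delta>0 by (simp add: Y_def)
      qed
      then have "X * measure lebesgue D < X * \<delta>"
        using X \<delta>0 by (simp add: field_simps) (smt (verit) mult_strict_right_mono mult.commute)
      then have D_small: "measure lebesgue D < \<delta>" using X by simp
      have "\<exists>p. p ` sphere 0 1 \<subseteq> sphere 0 1 \<and> p ` (\<Union>(a,b)\<in>B. closed_arc a b) \<subseteq> cis ` G \<and>
          (\<forall>w. p w = w \<or> p w \<in> cis ` G) \<and>
          (\<forall>w\<in>sphere 0 1. \<forall>w'\<in>sphere 0 1. \<kappa> ^ card B * cmod (w - w') \<le> cmod (p w - p w'))"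
      proof (rule arcs_stretch[OF B(1)])
        show "cis ` G \<subseteq> sphere 0 1" by auto
        fix a b assume ab: "(a, b) \<in> B"
        have sub: "{a..b} \<subseteq> (G \<inter> {a..b}) \<union> ((J - C) \<union> D)"
          using ab by (auto simp: J_def D_def G_def)
        have m1: "G \<inter> {a..b} \<in> lmeasurable" using G by (intro lmeasurable_compact compact_Int) auto
        have m2: "J - C \<in> lmeasurable" using J C(2) by (intro fmeasurable.Diff lmeasurable_compact)
        have "b - a = measure lebesgue {a..b}" using B(3)[OF ab] by simp
        also have "\<dots> \<le> measure lebesgue ((G \<inter> {a..b}) \<union> ((J - C) \<union> D))"
          using sub m1 m2 D_meas by (intro measure_mono_fmeasurable fmeasurable.Un) auto
        also have "\<dots> \<le> measure lebesgue (G \<inter> {a..b}) + (measure lebesgue (J - C) + measure lebesgue D)"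
          using m1 m2 D_meas
          by (intro order.trans[OF measure_Un_le] add_left_mono measure_Un_le) (auto intro: fmeasurableD sets.Un)
        finally have "measure lebesgue (G \<inter> {a..b}) \<ge> (b - a) - 2 * \<delta>"
          using C(5) D_small by linarith
        then have "measure lebesgue (G \<inter> {a..b}) \<ge> \<kappa> * (b - a)"
          using \<delta>(2)[OF ab] by (simp add: algebra_simps)
        moreover have "compact (G \<inter> {a..b})" using G by (intro compact_Int) auto
        ultimately show "a < b \<and> b \<le> a + 2 * pi \<and>
          (\<exists>\<Gamma>. compact \<Gamma> \<and> \<Gamma> \<subseteq> {a..b} \<and> cis ` \<Gamma> \<subseteq> cis ` G \<and> \<kappa> * (b - a) \<le> measure lebesgue \<Gamma>)"
          using B(3)[OF ab] by (intro conjI exI[of _ "G \<inter> {a..b}"]) auto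
      qed (use \<kappa> in auto)
      then obtain p where p: "p ` K \<subseteq> cis ` G"
        "\<And>w w'. w \<in> sphere 0 1 \<Longrightarrow> w' \<in> sphere 0 1 \<Longrightarrow> \<kappa> ^ card B * cmod (w - w') \<le> cmod (p w - p w')"
        unfolding K(1)[symmetric] by auto
      have "(\<kappa> ^ card B * transfinite_diameter K) ^ n \<le> sqrt Y"
      proof (rule monic_bound_ge_transfinite_diameter[OF K_sphere K(2) _ p(1) _ _ Q n])
        show "cis ` G \<subseteq> sphere 0 1" by auto
        show "\<kappa> ^ card B * cmod (x - y) \<le> cmod (p x - p y)" if "x \<in> K" "y \<in> K" for x y
          using that K_sphere by (intro p(2)) auto
        show "cmod (poly Q w) \<le> sqrt Y" if "w \<in> cis ` G" for w
          using that by (auto simp: G_def g_def intro: real_le_rsqrt)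
      qed (use \<kappa> Y in auto)
      then have "((\<kappa> ^ card B * transfinite_diameter K) ^ n)\<^sup>2 \<le> (sqrt Y)\<^sup>2"
        using \<kappa> diam_n_tendsto(3)[OF K_sphere K(2)] by (intro power_mono) auto
      then have "(\<kappa> ^ card B * transfinite_diameter K) ^ (2 * n) \<le> Y"
        using Y by (simp add: power_mult[symmetric] mult.commute)
      then show "\<delta> * \<eta> * (\<kappa> ^ card B * transfinite_diameter K) ^ (2 * n) \<le> I + e"
        using \<delta>0 C(1) unfolding Y_def X_def[symmetric] by (simp add: field_simps)
    qed
    then show "\<delta> * \<eta> * (\<kappa> ^ card B * transfinite_diameter K) ^ (2 * n)
        \<le> integral {-pi..pi} (\<lambda>l. (cmod (poly Q (cis l)))\<^sup>2 * f l)"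
      by (simp add: I_def g_def)
  qed
  moreover have "\<delta> * \<eta> > 0" using \<delta>0 C(1) by simp
  ultimately show ?thesis using that by blast
qed

text \<open>The polynomial of \<open>fekete_polynomial\<close> is the competitor. Its bound on
  \<open>K\<close> suffices, because the weight vanishes at angles outside the spectrum.\<close>

lemma pred_error_sq_upper_bound:
  assumes f: "spectral_density f" and K: "K \<subseteq> sphere 0 1" "infinite K" "spectrum_set f \<subseteq> K"
    and n: "n \<ge> 2"
  shows "pred_error_sq n f \<le> (2 * diam_n n K ^ n)\<^sup>2 * integral {-pi..pi} f"
proof -
  obtain Q where Q: "degree Q = n" "lead_coeff Q = 1"
    "\<And>w. w \<in> K \<Longrightarrow> cmod (poly Q w) \<le> 2 * diam_n n K ^ n"
    using fekete_polynomial[OF K(1,2) n] by blast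
  have "pred_error_sq n f \<le> integral {-pi..pi} (\<lambda>l. (cmod (poly Q (cis l)))\<^sup>2 * f l)"
    by (rule pred_error_sq_le[OF f Q(1,2)])
  also have "\<dots> \<le> integral {-pi..pi} (\<lambda>l. (2 * diam_n n K ^ n)\<^sup>2 * f l)"
  proof (rule integral_le)
    show "(\<lambda>l. (cmod (poly Q (cis l)))\<^sup>2 * f l) integrable_on {-pi..pi}"
      by (rule integrable_poly_weight[OF f])
    show "(\<lambda>l. (2 * diam_n n K ^ n)\<^sup>2 * f l) integrable_on {-pi..pi}"
      using f by (intro integrable_on_mult_right) (auto simp: spectral_density_def)
    fix l assume l: "l \<in> {-pi..pi}"
    show "(cmod (poly Q (cis l)))\<^sup>2 * f l \<le> (2 * diam_n n K ^ n)\<^sup>2 * f l"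
    proof (cases "f l > 0")
      case True
      then have "cis l \<in> K" using l K(3) by (auto simp: spectrum_set_def)
      then show ?thesis using Q(3) True by (intro mult_right_mono power_mono) auto
    next
      case False
      then have "f l = 0" using f l by (force simp: spectral_density_def)
      then show ?thesis by simp
    qed
  qed
  finally show ?thesis by simp
qed

theorem mainTheorem1:
  fixes f :: "real \<Rightarrow> real"
  assumes "spectral_density f"
    and "\<exists>A::(real \<times> real) set. finite A \<and> (\<forall>(a,b)\<in>A. a < b) \<and>
           closure (spectrum_set f) = (\<Union>(a,b)\<in>A. closed_arc a b)"
    and "AE l in lebesgue. (l \<in> {-pi..pi} \<and> cis l \<in> closure (spectrum_set f)) \<longrightarrow> f l > 0"
  shows "convergent (\<lambda>n. root n (pred_error n f)) \<and>
         (\<lambda>n. root n (pred_error n f)) \<longlonglongrightarrow> transfinite_diameter (closure (spectrum_set f))"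
proof -
  note f = assms(1)
  define K where "K = closure (spectrum_set f)"
  define \<tau> where "\<tau> = transfinite_diameter K"
  obtain A :: "(real \<times> real) set" where A: "finite A" "\<forall>(a,b)\<in>A. a < b" "K = (\<Union>(a,b)\<in>A. closed_arc a b)"
    using assms(2) unfolding K_def by blast
  obtain B where B: "finite B" "\<And>c d. (c, d) \<in> B \<Longrightarrow> -pi \<le> c \<and> c < d \<and> d \<le> pi"
    "K = (\<Union>(c,d)\<in>B. closed_arc c d)"
    using arcs_normalize[OF A(1,2)] A(3) by metis
  have "{l \<in> {-pi..pi}. f l > 0} \<noteq> {}"
    using f by (metis (lifting) emeasure_empty less_irrefl spectral_density_def)
  then have "spectrum_set f \<noteq> {}" by (auto simp: spectrum_set_def)
  then have "K \<noteq> {}" by (simp add: K_def)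
  then have "B \<noteq> {}" using B(3) by auto
  have K: "K \<subseteq> sphere 0 1" by (auto simp: B(3) closed_arc_def)
  \<comment> \<open>\<open>K\<close> contains an arc, and \<open>cis\<close> is injective on an
    interval of length at most \<open>pi\<close>, which explains the cap in \<open>d'\<close>.
    Infinitude selects the limit branch of \<open>transfinite_diameter\<close>.\<close>
  have "infinite K"
  proof -
    obtain c d where cd: "(c, d) \<in> B" using \<open>B \<noteq> {}\<close> by auto
    define d' where "d' = min d (c + pi)"
    have "inj_on cis {c..<d'}"
    proof (rule inj_onI)
      fix x y assume xy: "x \<in> {c..<d'}" "y \<in> {c..<d'}" "cis x = cis y"
      then have "sin ((x - y) / 2) = 0" using cmod_cis_diff[of x y] by simp
      moreover have "c \<le> x" "x < c + pi" "c \<le> y" "y < c + pi" using xy(1,2) by (auto simp: d'_def)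
      then have "-pi < (x - y) / 2" "(x - y) / 2 < pi" by (auto simp: field_simps)
      ultimately have "(x - y) / 2 = 0" using sin_eq_0_pi by blast
      then show "x = y" by simp
    qed
    moreover have "infinite {c..<d'}" using B(2)[OF cd] by (intro infinite_Ico) (auto simp: d'_def)
    ultimately have "infinite (cis ` {c..<d'})" by (simp add: finite_image_iff)
    moreover have "cis ` {c..<d'} \<subseteq> closed_arc c d" by (auto simp: closed_arc_def d'_def)
    moreover have "closed_arc c d \<subseteq> K" unfolding B(3) using cd by blast
    ultimately show ?thesis by (meson finite_subset)
  qed
  have sub: "spectrum_set f \<subseteq> K" unfolding K_def by (rule closure_subset)
  note diam = diam_n_tendsto[OF K \<open>infinite K\<close>]
  have pe0: "pred_error n f \<ge> 0" for n
    using pred_error_sq_nonneg[OF f] by (simp add: pred_error_def)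
  have pos: "AE l in lebesgue. l \<in> {-pi..pi} \<and> cis l \<in> K \<longrightarrow> f l > 0"
    using assms(3) unfolding K_def .
  have "(\<lambda>n. root n (pred_error n f)) \<longlonglongrightarrow> \<tau>"
  proof (rule order_tendstoI)
    fix y assume y: "\<tau> < y"
    \<comment> \<open>The summand 1 makes \<open>c\<close> positive, so that its \<open>n\<close>-th
      root tends to 1.\<close>
    define c where "c = 2 * sqrt (integral {-pi..pi} f) + 1"
    have int0: "integral {-pi..pi} f \<ge> 0"
      using f by (intro integral_nonneg) (auto simp: spectral_density_def)
    then have c: "c > 0" by (simp add: c_def add_nonneg_pos)
    have "(\<lambda>n. root n c * diam_n n K) \<longlonglongrightarrow> 1 * \<tau>"
      unfolding \<tau>_def by (intro tendsto_mult LIMSEQ_root_const c diam)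
    then have "\<forall>\<^sub>F n in sequentially. root n c * diam_n n K < y"
      using y by (intro order_tendstoD(2)) auto
    then show "\<forall>\<^sub>F n in sequentially. root n (pred_error n f) < y"
      using eventually_ge_at_top[of 2]
    proof eventually_elim
      case (elim n)
      have d: "diam_n n K > 0" by (rule diam_n_pos[OF K \<open>infinite K\<close> elim(2)])
      have "pred_error n f \<le> sqrt ((2 * diam_n n K ^ n)\<^sup>2 * integral {-pi..pi} f)"
        unfolding pred_error_def
        by (intro real_sqrt_le_mono pred_error_sq_upper_bound[OF f K \<open>infinite K\<close> sub elim(2)])
      also have "\<dots> = 2 * sqrt (integral {-pi..pi} f) * diam_n n K ^ n"
        using d by (simp add: real_sqrt_mult)
      also have "\<dots> \<le> c * diam_n n K ^ n"
        using d by (intro mult_right_mono) (auto simp: c_def)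
      finally have "root n (pred_error n f) \<le> root n (c * diam_n n K ^ n)"
        using elim(2) by (intro real_root_le_mono) auto
      also have "\<dots> = root n c * diam_n n K"
        using elim(2) d by (simp add: real_root_mult real_root_power_cancel)
      finally show ?case using elim(1) by simp
    qed
  next
    fix y assume y: "y < \<tau>"
    show "\<forall>\<^sub>F n in sequentially. y < root n (pred_error n f)"
    \<comment> \<open>Negative \<open>y\<close> lie below every error. Otherwise
      \<open>\<tau>\<close> is positive, as needed to extract roots in the lower bound.\<close>
    proof (cases "y < 0")
      case True
      show ?thesis
      proof (rule always_eventually, rule allI)
        fix n
        have "root n (pred_error n f) \<ge> 0" using pe0 by (intro real_root_pos_pos_le)
        then show "y < root n (pred_error n f)" using True by linarith
      qed
    next
      case False
      then have tau: "\<tau> > 0" using y by simp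
      \<comment> \<open>All arcs together cost the factor \<open>\<kappa> ^ card B\<close>. As the
        number of arcs is fixed, some \<open>\<kappa>\<close> below 1, independent of
        \<open>n\<close>, still keeps the product above \<open>y\<close>.\<close>
      have "((\<lambda>\<kappa>. \<kappa> ^ card B * \<tau>) \<longlongrightarrow> 1 ^ card B * \<tau>) (at_left (1::real))"
        by (intro tendsto_intros)
      then have "\<forall>\<^sub>F \<kappa> in at_left 1. y < \<kappa> ^ card B * \<tau>"
        using y by (intro order_tendstoD(1)) auto
      moreover have "\<forall>\<^sub>F \<kappa> in at_left 1. \<kappa> \<in> {0<..<1::real}"
        by (rule eventually_at_left_real) simp
      ultimately have "\<forall>\<^sub>F \<kappa> in at_left (1::real). y < \<kappa> ^ card B * \<tau> \<and> \<kappa> \<in> {0<..<1}"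
        by (rule eventually_conj)
      then obtain \<kappa> where \<kappa>: "y < \<kappa> ^ card B * \<tau>" "0 < \<kappa>" "\<kappa> < 1"
        using eventually_happens'[OF trivial_limit_at_left_real] by force
      obtain c where c: "c > 0"
        "\<And>n. n > 0 \<Longrightarrow> c * (\<kappa> ^ card B * \<tau>) ^ (2 * n) \<le> pred_error_sq n f"
        unfolding \<tau>_def
        using pred_error_sq_lower_bound[OF f B(1) \<open>B \<noteq> {}\<close> B(2,3) \<open>infinite K\<close> pos \<kappa>(2,3)] by blast
      have t0: "\<kappa> ^ card B * \<tau> > 0" using \<kappa> tau by simp
      have "(\<lambda>n. root n (sqrt c) * (\<kappa> ^ card B * \<tau>)) \<longlonglongrightarrow> 1 * (\<kappa> ^ card B * \<tau>)"
        using c(1) by (intro tendsto_intros LIMSEQ_root_const) auto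
      then have "\<forall>\<^sub>F n in sequentially. y < root n (sqrt c) * (\<kappa> ^ card B * \<tau>)"
        using \<kappa>(1) by (intro order_tendstoD(1)) auto
      then show ?thesis
        using eventually_gt_at_top[of 0]
      proof eventually_elim
        case (elim n)
        have "root n (sqrt c) * (\<kappa> ^ card B * \<tau>) = root n (sqrt c * (\<kappa> ^ card B * \<tau>) ^ n)"
          using elim(2) t0 by (simp only: real_root_mult real_root_power_cancel less_imp_le)
        also have "sqrt c * (\<kappa> ^ card B * \<tau>) ^ n = sqrt (c * (\<kappa> ^ card B * \<tau>) ^ (2 * n))"
        proof -
          have "(\<kappa> ^ card B * \<tau>) ^ (2 * n) = ((\<kappa> ^ card B * \<tau>) ^ n)\<^sup>2"
            by (simp only: power_mult[symmetric] mult.commute)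
          then show ?thesis using t0 by (simp only: real_sqrt_mult real_sqrt_abs) simp
        qed
        also have "root n \<dots> \<le> root n (pred_error n f)"
          unfolding pred_error_def
          by (intro real_root_le_mono real_sqrt_le_mono c elim)
        finally show ?case using elim(1) by simp
      qed
    qed
  qed
  then show ?thesis unfolding \<tau>_def K_def convergent_def by blast
qed

end
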